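(* Let $w(n)$, $n=1,2,\ldots$, be an increasing sequence of positive numbers with $w(n)=o(\log n)$ as $n\to\infty$. Then $w(n)$ fails to be an RC-multiplier for the trigonometric system $\{e^{2\pi i n x}: n=1,2,\ldots\}$. Moreover, there are complex coefficients $a_n$ satisfying $$\sum_{n=1}^\infty |a_n|^2w(n)<\infty$$ and a permutation $\sigma$ of $\{1,2,3,\ldots\}$ such that the series $$\sum_{n=1}^\infty a_ne^{2\pi i\sigma(n)x}$$ diverges for almost every $x$.
   Context: Let $\Phi=\{\phi_n:n=1,2,\ldots\}$ be an orthonormal system in $L^2(0,1)$. A sequence of positive numbers $w(n)\nearrow\infty$ is a C-multiplier (a.e. convergence Weyl multiplier) for $\Phi$ if every series $\sum_{n=1}^\infty a_n\phi_n(x)$ with $\sum_{n=1}^\infty |a_n|^2w(n)<\infty$ converges almost everywhere. It is an RC-multiplier (a.e. convergence Weyl multiplier for the rearrangements) for $\Phi$ if it is a C-multiplier for every rearrangement $\{\phi_{\sigma(n)}\}_{n\ge1}$ of $\Phi$, where $\sigma$ is a permutation of the positive integers. *)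

theory Defs
  imports "HOL-Analysis.Analysis" "HOL-Library.Landau_Symbols"
begin

text \<open>
  Sequences \<open>x\<^sub>1, x\<^sub>2, \<dots>\<close> are functions on \<^typ>\<open>nat\<close> of which only the values at positive
  arguments matter; the series \<open>x\<^sub>1 + x\<^sub>2 + \<dots>\<close> converges iff
  \<open>summable (\<lambda>n. x (Suc n))\<close>.
\<close>

definition orthonormal_system :: "(nat \<Rightarrow> real \<Rightarrow> complex) \<Rightarrow> bool" where
  "orthonormal_system \<phi> \<longleftrightarrow>
     (\<forall>n\<ge>1. \<phi> n \<in> borel_measurable (lebesgue_on {0<..<1}) \<and>
            integrable (lebesgue_on {0<..<1}) (\<lambda>x. (cmod (\<phi> n x))\<^sup>2)) \<and>
     (\<forall>m\<ge>1. \<forall>n\<ge>1. (LINT x|lebesgue_on {0<..<1}. \<phi> m x * cnj (\<phi> n x)) = of_bool (m = n))"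

text \<open>
  The notions of multiplier are meant for orthonormal systems \<open>\<phi>\<close> and for increasing sequences
  \<open>w\<close> of positive numbers tending to infinity. These standing assumptions are deliberately not
  conjuncts of the definitions: the negation of \<open>C_multiplier\<close> asserts that convergence fails, and
  cannot hold merely because \<open>w\<close> is bounded, say.
\<close>

definition C_multiplier :: "(nat \<Rightarrow> real) \<Rightarrow> (nat \<Rightarrow> real \<Rightarrow> complex) \<Rightarrow> bool" where
  "C_multiplier w \<phi> \<longleftrightarrow>
     (\<forall>a :: nat \<Rightarrow> complex.
        summable (\<lambda>n. (cmod (a (Suc n)))\<^sup>2 * w (Suc n)) \<longrightarrow>
        (AE x in lebesgue_on {0<..<1}. summable (\<lambda>n. a (Suc n) * \<phi> (Suc n) x)))"

definition RC_multiplier :: "(nat \<Rightarrow> real) \<Rightarrow> (nat \<Rightarrow> real \<Rightarrow> complex) \<Rightarrow> bool" where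
  "RC_multiplier w \<phi> \<longleftrightarrow>
     (\<forall>\<sigma>. bij_betw \<sigma> {1..} {1..} \<longrightarrow> C_multiplier w (\<lambda>n. \<phi> (\<sigma> n)))"

definition trig_system :: "nat \<Rightarrow> real \<Rightarrow> complex" where
  "trig_system n x = exp (2 * of_real pi * \<i> * of_nat n * of_real x)"

lemma orthonormal_system_trig_system: "orthonormal_system trig_system"
proof -
  let ?M = "lebesgue_on {0<..<1::real}"
  have cont: "continuous_on S (trig_system n)" for n S
    unfolding trig_system_def by (intro continuous_intros)
  have meas: "trig_system n \<in> borel_measurable ?M" for n
    by (rule continuous_imp_measurable_on_sets_lebesgue[OF cont]) auto
  have norm1: "cmod (trig_system n x) = 1" for n x
    by (simp add: trig_system_def norm_exp_eq_Re)
  have prod: "trig_system m x * cnj (trig_system n x)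
      = exp (2 * of_real pi * \<i> * of_int (int m - int n) * of_real x)" for m n x
    by (simp add: trig_system_def exp_cnj flip: exp_add) (simp add: algebra_simps)
  have orth: "(LINT x|?M. trig_system m x * cnj (trig_system n x)) = of_bool (m = n)" for m n
  proof (cases "m = n")
    case True
    then show ?thesis
      by (simp add: prod measure_restrict_space)
  next
    case False
    define c where "c = 2 * of_real pi * \<i> * of_int (int m - int n)"
    have c0: "c \<noteq> 0" using False by (simp add: c_def)
    have ec: "exp c = 1"
      by (auto simp: exp_eq_1 c_def) (metis of_int_diff of_int_of_nat_eq)
    have hi: "((\<lambda>x. exp (c * of_real x)) has_integral (exp (c * of_real 1) / c - exp (c * of_real 0) / c)) {0..1}"
      by (rule fundamental_theorem_of_calculus)
         (auto intro!: derivative_eq_intros has_vector_derivative_real_field simp: c0)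
    have "(\<lambda>x::real. exp (c * of_real x)) absolutely_integrable_on {0..1}"
      by (intro absolutely_integrable_continuous_real continuous_intros)
    then have "(\<lambda>x::real. exp (c * of_real x)) absolutely_integrable_on {0<..<1}"
      by (rule set_integrable_subset) auto
    then have "integrable ?M (\<lambda>x::real. exp (c * of_real x))"
      by (rule absolutely_integrable_imp_integrable) auto
    then have "(LINT x|?M. exp (c * of_real x)) = integral {0<..<1} (\<lambda>x. exp (c * of_real x))"
      by (rule lebesgue_integral_eq_integral) auto
    also have "\<dots> = 0"
      using hi ec by (simp add: integral_unique flip: integral_open_interval_real)
    finally show ?thesis using False by (simp add: prod c_def)
  qed
  show ?thesis
    unfolding orthonormal_system_def using meas orth
    by (simp add: norm1 finite_measure.integrable_const finite_measure_lebesgue_on)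
qed

end

theory Submission
  imports Defs "HOL-Library.Sublist"
begin

text \<open>
  Label the nodes of the binary tree of depth \<open>n\<close> by very lacunary frequencies \<open>m\<^sub>u\<close>. To a node \<open>v\<close>
  belongs the function that equals the sign of \<open>sin (2 \<pi> m\<^sub>v x)\<close> on the set of those \<open>x\<close> for which
  the signs at the ancestors of \<open>v\<close> lead to \<open>v\<close>, and \<open>0\<close> elsewhere. The \<open>n\<close> levels contribute
  energy \<open>1\<close> each. In the in-order traversal of the tree, every \<open>x\<close> meets first all the values \<open>-1\<close>
  on its path and then all the values \<open>+1\<close>, so some block of consecutive functions sums to at
  least \<open>n/2\<close> in modulus.

  The sign functions are replaced by partial sums of the Fourier series of the square wave; their
  length does not matter, because afterwards only the coefficients of modulus at least
  \<open>\<tau> = c\<^sup>-\<^sup>n\<close> are kept. There are at most \<open>\<tau>\<^sup>-\<^sup>2\<close> of these per node, and the rest is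
  exponentially small in \<open>L\<^sup>2\<close>, because the \<open>\<ell>\<^bsup>3/2\<^esub>\<close> norm of the coefficients is
  multiplicative. So \<open>C\<^sup>n\<close> exponentials with energy \<open>n\<close> reach a block sum of order \<open>n\<close> outside a
  set of measure \<open>2\<^bsup>1-n\<^esup>\<close>. Since \<open>w (2 C\<^sup>n) = o(n)\<close>, suitable multiples of such blocks can be put
  together to an almost everywhere divergent series.
\<close>

subsection \<open>Partial sums of the square wave\<close>

text \<open>Each term times \<open>2 * sin t\<close> is a difference of two sines, so the sum
  telescopes. It turns the derivative of \<open>square_wave\<close> into a single oscillating
  quotient.\<close>

lemma sum_cos_odd: "(\<Sum>i<J. cos (real (2*i+1) * t)) * (2 * sin t) = sin (2 * real J * t)"
proof (induction J)
  case (Suc J)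
  have "sin (2 * real (Suc J) * t) - sin (2 * real J * t) = 2 * sin t * cos (real (2*J+1) * t)"
  proof -
    have "(2 * real (Suc J) * t - 2 * real J * t) / 2 = t"
      "(2 * real (Suc J) * t + 2 * real J * t) / 2 = real (2*J+1) * t"
      by (simp_all add: field_simps)
    then show ?thesis unfolding sin_diff_sin by simp
  qed
  then show ?case using Suc by (simp add: algebra_simps)
qed simp

text \<open>The partial sum with \<open>J\<close> terms of the Fourier series of the sign of
  \<open>sin t\<close>.\<close>

definition square_wave :: "nat \<Rightarrow> real \<Rightarrow> real" where
  "square_wave J t = 4 / pi * (\<Sum>i<J. sin (real (2*i+1) * t) / real (2*i+1))"

text \<open>The sine of an odd multiple of \<open>u\<close> is a polynomial in \<open>sin u\<close>:
  the three-term recurrence has the factor \<open>2 * cos (2 * u)\<close>, which depends on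
  \<open>sin u\<close> alone. So \<open>square_wave\<close> needs to be estimated on one quarter
  period only, up to sign.\<close>

lemma sin_odd_multiple_cong:
  assumes "sin s = sin t"
  shows "sin (real (2*i+1) * s) = sin (real (2*i+1) * t)"
proof (induction i rule: induct_nat_012)
  case 1
  have "sin (3 * u) = 2 * (1 - 2 * (sin u)\<^sup>2) * sin u + sin u" for u :: real
  proof -
    have "sin (3 * u) - sin u = 2 * sin u * cos (2 * u)"
      by (simp add: sin_diff_sin)
    then have "sin (3 * u) = 2 * sin u * cos (2 * u) + sin u" by simp
    then show ?thesis unfolding cos_double_sin by (simp add: algebra_simps)
  qed
  then show ?case using assms by simp
next
  case (ge2 n)
  have rec: "sin (real (2*(Suc (Suc n))+1) * u)
      = 2 * (1 - 2 * (sin u)\<^sup>2) * sin (real (2*(Suc n)+1) * u) - sin (real (2*n+1) * u)" for u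
  proof -
    have "sin (real (2*(Suc (Suc n))+1) * u) + sin (real (2*n+1) * u)
        = 2 * sin (real (2*(Suc n)+1) * u) * cos (2 * u)"
    proof -
      have "(real (2*(Suc (Suc n))+1) * u + real (2*n+1) * u) / 2 = real (2*(Suc n)+1) * u"
        "(real (2*(Suc (Suc n))+1) * u - real (2*n+1) * u) / 2 = 2 * u"
        by (simp_all add: field_simps)
      then show ?thesis unfolding sin_plus_sin by simp
    qed
    then show ?thesis unfolding cos_double_sin by (simp add: algebra_simps)
  qed
  show ?case unfolding rec[of s] rec[of t] using ge2 assms by simp
qed (use assms in auto)

lemma square_wave_cong: "sin s = sin t \<Longrightarrow> square_wave J s = square_wave J t"
  unfolding square_wave_def using sin_odd_multiple_cong[of s t] by simp

lemma square_wave_minus: "square_wave J (- t) = - square_wave J t"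
  by (simp add: square_wave_def sum_negf)

lemma square_wave_deriv:
  assumes "sin t \<noteq> 0"
  shows "(square_wave J has_real_derivative 2 / pi * sin (2 * real J * t) / sin t) (at t)"
proof -
  have "(square_wave J has_real_derivative 4 / pi * (\<Sum>i<J. cos (real (2*i+1) * t))) (at t)"
    unfolding square_wave_def
    by (auto intro!: derivative_eq_intros sum.cong simp: divide_simps)
  moreover have "4 / pi * (\<Sum>i<J. cos (real (2*i+1) * t)) = 2 / pi * sin (2 * real J * t) / sin t"
    using assms unfolding sum_cos_odd[symmetric] by simp
  ultimately show ?thesis by simp
qed

text \<open>At \<open>pi/2\<close> the sum is a partial sum of the Leibniz series for
  \<open>pi/4\<close>, times \<open>4/pi\<close>; such an alternating series errs by at most its
  first omitted term.\<close>

lemma square_wave_half_pi: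
  "\<bar>square_wave J (pi/2) - 1\<bar> \<le> 4 / pi / (2 * real J + 1)"
proof -
  define a where "a i = 1 / real (2*i+1)" for i
  have a0: "a \<longlonglongrightarrow> 0"
    unfolding a_def by real_asymp
  have mono: "a (Suc n) \<le> a n" for n by (simp add: a_def field_simps)
  have pos: "0 \<le> a n" for n by (simp add: a_def)
  have sw: "square_wave J (pi/2) = 4/pi * (\<Sum>i<J. (-1)^i * a i)"
    unfolding square_wave_def a_def
  proof (intro arg_cong2[of _ _ _ _ "(*)"] refl sum.cong)
    fix i :: nat
    have "sin (real (2*i+1) * (pi/2)) = (-1)^i"
    proof -
      have "real (2*i+1) * (pi/2) = pi / 2 - (- (real i * pi))" by (simp add: field_simps)
      then have "sin (real (2*i+1) * (pi/2)) = cos (real i * pi)"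
        using cos_sin_eq[of "- (real i * pi)"] by (simp only: cos_minus of_real_eq_id id_apply)
      then show ?thesis by (simp only: cos_npi)
    qed
    then show "sin (real (2*i+1) * (pi/2)) / real (2*i+1) = (-1)^i * (1 / real (2*i+1))" by simp
  qed
  have pi4: "(\<Sum>i. (-1)^i * a i) = pi/4"
    unfolding a_def pi_series by (simp add: mult.commute)
  have lo: "(\<Sum>i<2*n. (-1)^i * a i) \<le> pi/4" and hi: "pi/4 \<le> (\<Sum>i<2*n+1. (-1)^i * a i)" for n
    using summable_Leibniz'(2)[of a n] summable_Leibniz'(4)[of a n] a0 pos mono pi4 by auto
  have "\<bar>(\<Sum>i<J. (-1)^i * a i) - pi/4\<bar> \<le> a J"
  proof (cases "even J")
    case True
    then obtain n where n: "J = 2*n" by blast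
    show ?thesis using lo[of n] hi[of n] by (simp add: n)
  next
    case False
    then obtain n where n: "J = 2*n+1" by (auto elim: oddE)
    have "(\<Sum>i<2*(Suc n). (-1)^i * a i) = (\<Sum>i<2*n+1. (-1)^i * a i) - a J"
      by (simp add: n)
    then show ?thesis using lo[of "Suc n"] hi[of n] n by simp
  qed
  then have "4/pi * \<bar>(\<Sum>i<J. (-1)^i * a i) - pi/4\<bar> \<le> 4/pi * a J"
    by (intro mult_left_mono) auto
  moreover have "square_wave J (pi/2) - 1 = 4/pi * ((\<Sum>i<J. (-1)^i * a i) - pi/4)"
    by (simp add: sw right_diff_distrib)
  ultimately have "\<bar>square_wave J (pi/2) - 1\<bar> \<le> 4/pi * a J"
    by (simp only: abs_mult) simp
  then show ?thesis by (simp add: a_def add.commute)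
qed

text \<open>Integration by parts, carried out through monotonicity. The derivative of
  \<open>square_wave\<close> oscillates, so the variation between \<open>t\<close> and
  \<open>pi/2\<close> is of order \<open>1 / (J * sin t)\<close>, and at \<open>pi/2\<close> the
  error is known.\<close>

lemma square_wave_approx_quarter:
  assumes J: "J > 0" and t: "0 < t" "t \<le> pi/2"
  shows "\<bar>square_wave J t - 1\<bar> \<le> 4 / (real J * sin t)"
proof -
  \<comment> \<open>The added quotient cancels the oscillating derivative of
    \<open>square_wave\<close> and leaves \<open>- X\<close>, where the modulus of \<open>X\<close>
    is at most \<open>B\<close>, the negative of the derivative of \<open>h\<close>. So
    \<open>h + g\<close> and \<open>h - g\<close> are both nonincreasing, which bounds the variation
    of \<open>g\<close> by that of \<open>h\<close>.\<close>
  define g where "g u = square_wave J u + cos (2 * real J * u) / (pi * J * sin u)" for u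
  define h where "h u = 1 / (pi * J * sin u)" for u
  have sp: "sin u > 0" if "t \<le> u" "u \<le> pi/2" for u
    using that t pi_gt_zero by (intro sin_gt_zero) linarith+
  have cp: "cos u \<ge> 0" if "t \<le> u" "u \<le> pi/2" for u
    using that t pi_gt_zero by (intro cos_ge_zero) linarith+
  define B where "B u = cos u / (pi * J * (sin u)\<^sup>2)" for u
  define X where "X u = cos (2 * real J * u) * B u" for u
  have dg: "(g has_real_derivative - X u) (at u)"
    if "t \<le> u" "u \<le> pi/2" for u
    unfolding g_def X_def B_def using sp[OF that] J
    by (auto intro!: derivative_eq_intros square_wave_deriv simp: field_simps power2_eq_square)
  have dh: "(h has_real_derivative - B u) (at u)"
    if "t \<le> u" "u \<le> pi/2" for u
    unfolding h_def B_def using sp[OF that] J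
    by (auto intro!: derivative_eq_intros simp: field_simps power2_eq_square)
  have bnd: "\<bar>X u\<bar> \<le> B u" if "t \<le> u" "u \<le> pi/2" for u
  proof -
    have "\<bar>cos (2 * real J * u)\<bar> * B u \<le> 1 * B u"
      using cp[OF that] by (intro mult_right_mono) (auto simp: B_def)
    then show ?thesis using cp[OF that] by (simp add: X_def abs_mult B_def)
  qed
  have "h (pi/2) + g (pi/2) \<le> h t + g t"
  proof (rule DERIV_nonpos_imp_nonincreasing[of t "pi/2" "\<lambda>u. h u + g u"])
    fix u assume u: "t \<le> u" "u \<le> pi/2"
    show "\<exists>y. ((\<lambda>u. h u + g u) has_real_derivative y) (at u) \<and> y \<le> 0"
      using DERIV_add[OF dh[OF u] dg[OF u]] bnd[OF u]
      by (intro exI[of _ "- B u + - X u"]) (simp add: abs_le_iff)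
  qed (use t in auto)
  moreover have "h (pi/2) - g (pi/2) \<le> h t - g t"
  proof (rule DERIV_nonpos_imp_nonincreasing[of t "pi/2" "\<lambda>u. h u - g u"])
    fix u assume u: "t \<le> u" "u \<le> pi/2"
    show "\<exists>y. ((\<lambda>u. h u - g u) has_real_derivative y) (at u) \<and> y \<le> 0"
      using DERIV_diff[OF dh[OF u] dg[OF u]] bnd[OF u]
      by (intro exI[of _ "- B u - - X u"]) (simp add: abs_le_iff)
  qed (use t in auto)
  moreover have osc: "\<bar>g u - square_wave J u\<bar> \<le> h u" if "t \<le> u" "u \<le> pi/2" for u
  proof -
    have "\<bar>cos (2 * real J * u)\<bar> / (pi * J * sin u) \<le> 1 / (pi * J * sin u)"
      using sp[OF that] J by (intro divide_right_mono) auto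
    then show ?thesis using sp[OF that] by (simp add: g_def h_def abs_mult)
  qed
  moreover have "h (pi/2) \<ge> 0" by (simp add: h_def)
  ultimately have "\<bar>square_wave J t - square_wave J (pi/2)\<bar> \<le> 2 * h t"
    using osc[OF order_refl t(2)] osc[OF t(2) order_refl] by linarith
  moreover have "2 * h t \<le> 2 / (real J * sin t)"
  proof -
    have "1 \<le> pi" using pi_ge_two by linarith
    then have "real J * sin t * 1 \<le> real J * sin t * pi"
      using sp[of t] t J by (intro mult_left_mono) auto
    then show ?thesis using sp[of t] t J by (simp add: h_def field_simps)
  qed
  moreover have "4 / pi / (2 * real J + 1) \<le> 2 / (real J * sin t)"
  proof -
    have "4 / pi / (2 * real J + 1) \<le> 2 / (2 * real J + 1)"
      using pi_ge_two by (intro divide_right_mono) (auto simp: field_simps)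
    also have "\<dots> \<le> 2 / (real J * sin t)"
    proof (intro divide_left_mono)
      have "real J * sin t \<le> real J * 1" by (intro mult_left_mono) auto
      then show "real J * sin t \<le> 2 * real J + 1" by simp
    qed (use sp[of t] t J in auto)
    finally show ?thesis .
  qed
  moreover have triangle: "\<bar>a - 1\<bar> \<le> d + d"
    if "\<bar>b - 1\<bar> \<le> e" "\<bar>a - b\<bar> \<le> c" "c \<le> d" "e \<le> d" for a b c d e :: real
    using that by linarith
  ultimately have "\<bar>square_wave J t - 1\<bar> \<le> 2 / (real J * sin t) + 2 / (real J * sin t)"
    by (intro triangle[OF square_wave_half_pi]) auto
  then show ?thesis by simp
qed

text \<open>A positive sine is moved to the angle \<open>arcsin (sin t)\<close> in the first quarter
  period; a negative one is handled by oddness.\<close>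

lemma square_wave_approx:
  assumes J: "J > 0" and t: "sin t \<noteq> 0"
  shows "\<bar>square_wave J t - sgn (sin t)\<bar> \<le> 4 / (real J * \<bar>sin t\<bar>)"
proof -
  have pos: "\<bar>square_wave J t - 1\<bar> \<le> 4 / (real J * sin t)" if "sin t > 0" for t
  proof -
    define u where "u = arcsin (sin t)"
    have "sin u = sin t" by (simp add: u_def)
    moreover have "0 < u" using that arcsin_less_arcsin[of 0 "sin t"] by (simp add: u_def)
    moreover have "u \<le> pi/2" unfolding u_def by (intro arcsin_ubound) auto
    ultimately show ?thesis using square_wave_approx_quarter[OF J, of u] square_wave_cong[of u t J] by simp
  qed
  show ?thesis
  proof (cases "sin t > 0")
    case True then show ?thesis using pos[of t] by simp
  next
    case False
    then show ?thesis using pos[of "-t"] t by (simp add: square_wave_minus abs_if split: if_splits)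
  qed
qed

text \<open>Coefficients of \<open>square_wave J\<close> in complex form: the terms at
  \<open>k\<close> and \<open>- k\<close> add up to \<open>4 / (pi * k) * sin (k * t)\<close>. The
  sums below range over \<open>- 2 * J..2 * J\<close>, which contains the support and also
  \<open>0\<close>.\<close>

definition square_coeff :: "nat \<Rightarrow> int \<Rightarrow> complex" where
  "square_coeff J k = (if odd k \<and> \<bar>k\<bar> < 2 * int J then 2 / (\<i> * of_real pi * of_int k) else 0)"

lemma sum_odd_symmetric:
  fixes h :: "int \<Rightarrow> 'a::comm_monoid_add"
  shows "(\<Sum>k\<in>{- 2 * int J..2 * int J}. if odd k \<and> \<bar>k\<bar> < 2 * int J then h k else 0)
    = (\<Sum>i<J. h (2 * int i + 1) + h (- (2 * int i + 1)))"
proof -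
  define S where "S J = {k::int. odd k \<and> \<bar>k\<bar> < 2 * int J}" for J
  have fin: "finite (S J)" for J
    by (rule finite_subset[of _ "{- 2 * int J..2 * int J}"]) (auto simp: S_def)
  have "(\<Sum>k\<in>{- 2 * int J..2 * int J}. if odd k \<and> \<bar>k\<bar> < 2 * int J then h k else 0) = sum h (S J)"
    by (rule sum.mono_neutral_cong_right) (auto simp: S_def)
  also have "\<dots> = (\<Sum>i<J. h (2 * int i + 1) + h (- (2 * int i + 1)))"
  proof (induction J)
    case (Suc J)
    have eq: "S (Suc J) = insert (2 * int J + 1) (insert (- (2 * int J + 1)) (S J))"
    proof (intro set_eqI)
      fix k :: int
      show "k \<in> S (Suc J) \<longleftrightarrow> k \<in> insert (2 * int J + 1) (insert (- (2 * int J + 1)) (S J))"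
        unfolding S_def by (simp add: abs_less_iff) presburger
    qed
    have "sum h (S (Suc J)) = h (2 * int J + 1) + (h (- (2 * int J + 1)) + sum h (S J))"
      unfolding eq using fin by (subst sum.insert, simp, simp add: S_def) (subst sum.insert, auto simp: S_def)
    then show ?case using Suc by (simp add: algebra_simps)
  qed (simp add: S_def)
  finally show ?thesis .
qed

lemma square_wave_fourier:
  "(\<Sum>k\<in>{- 2 * int J..2 * int J}. square_coeff J k * cis (of_int k * t)) = of_real (square_wave J t)"
proof -
  have "(\<Sum>k\<in>{- 2 * int J..2 * int J}. square_coeff J k * cis (of_int k * t))
     = (\<Sum>k\<in>{- 2 * int J..2 * int J}. if odd k \<and> \<bar>k\<bar> < 2 * int J then 2 / (\<i> * of_real pi * of_int k) * cis (of_int k * t) else 0)"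
    by (rule sum.cong) (auto simp: square_coeff_def)
  also have "\<dots> = (\<Sum>i<J. of_real (4 / pi * (sin (real (2*i+1) * t) / real (2*i+1))))"
  proof (subst sum_odd_symmetric, rule sum.cong)
    fix i
    define K where "K = 2 * int i + 1"
    define r where "r = real (2*i+1)"
    have K: "(of_int K :: complex) = of_real r" "(of_int K :: real) = r" by (simp_all add: K_def r_def)
    have r0: "r > 0" by (simp add: r_def)
    show "2 / (\<i> * of_real pi * of_int (2 * int i + 1)) * cis (of_int (2 * int i + 1) * t) +
         2 / (\<i> * of_real pi * of_int (- (2 * int i + 1))) * cis (of_int (- (2 * int i + 1)) * t) =
         of_real (4 / pi * (sin (real (2*i+1) * t) / real (2*i+1)))"
      unfolding K_def[symmetric] r_def[symmetric] of_int_minus K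
      using r0 by (simp add: complex_eq_iff Re_divide Im_divide power2_eq_square field_simps)
  qed simp
  also have "\<dots> = of_real (square_wave J t)"
    by (simp only: square_wave_def sum_distrib_left of_real_sum)
  finally show ?thesis .
qed

text \<open>The even squares contribute a quarter of the Basel sum \<open>pi\<^sup>2 / 6\<close>, so
  the odd squares give three quarters of it in the limit. Since \<open>f\<close> is indexed from
  \<open>0\<close>, the odd squares are its terms of even index.\<close>

lemma sum_inverse_odd_squares: "(\<Sum>i<J. 1 / (real (2*i+1))\<^sup>2) \<le> pi\<^sup>2 / 8"
proof -
  define f where "f n = 1 / (real n + 1)\<^sup>2" for n
  have f: "f sums (pi\<^sup>2/6)" using inverse_squares_sums by (simp add: f_def[abs_def] add.commute)
  have split: "(\<Sum>n<2*J. f n) = (\<Sum>i<J. 1 / (real (2*i+1))\<^sup>2) + (\<Sum>n<J. f n) / 4" for J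
  proof (induction J)
    case (Suc J)
    have "f (2*J+1) = f J / 4" by (simp add: f_def field_simps power2_eq_square)
    then show ?case using Suc by (simp add: f_def algebra_simps add_divide_distrib)
  qed simp
  have lim: "(\<lambda>J. (\<Sum>n<2*J. f n) - (\<Sum>n<J. f n) / 4) \<longlonglongrightarrow> pi\<^sup>2/6 - pi\<^sup>2/6/4"
  proof (intro tendsto_intros)
    show S: "(\<lambda>J. \<Sum>n<J. f n) \<longlonglongrightarrow> pi\<^sup>2/6" using f by (simp add: sums_def)
    show "(\<lambda>J. \<Sum>n<2*J. f n) \<longlonglongrightarrow> pi\<^sup>2/6"
      using LIMSEQ_subseq_LIMSEQ[OF S, of "\<lambda>J. 2*J"] by (simp add: o_def strict_mono_def)
  qed auto
  have "incseq (\<lambda>J. \<Sum>i<J. 1 / (real (2*i+1))\<^sup>2)" by (intro incseq_SucI) simp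
  moreover have "(\<lambda>J. \<Sum>i<J. 1 / (real (2*i+1))\<^sup>2) \<longlonglongrightarrow> pi\<^sup>2/8"
    using lim by (simp add: split)
  ultimately show ?thesis by (rule incseq_le)
qed

text \<open>Bessel's inequality for the sign of \<open>sin t\<close>, whose mean square is
  \<open>1\<close>, obtained here from the odd part of the Basel sum.\<close>

lemma square_coeff_energy: "(\<Sum>k\<in>{- 2 * int J..2 * int J}. (cmod (square_coeff J k))\<^sup>2) \<le> 1"
proof -
  have "(\<Sum>k\<in>{- 2 * int J..2 * int J}. (cmod (square_coeff J k))\<^sup>2)
    = (\<Sum>k\<in>{- 2 * int J..2 * int J}. if odd k \<and> \<bar>k\<bar> < 2 * int J then 4 / (pi\<^sup>2 * (of_int k)\<^sup>2) else 0)"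
    by (rule sum.cong) (auto simp: square_coeff_def norm_divide norm_mult power_divide power_mult_distrib)
  also have "\<dots> = 8 / pi\<^sup>2 * (\<Sum>i<J. 1 / (real (2*i+1))\<^sup>2)"
    unfolding sum_odd_symmetric sum_distrib_left
  proof (rule sum.cong)
    fix i
    define r where "r = real (2*i+1)"
    have *: "of_int (2 * int i + 1) = r" "of_int (- (2 * int i + 1)) = -r" by (simp_all add: r_def)
    show "4 / (pi\<^sup>2 * (of_int (2 * int i + 1))\<^sup>2) + 4 / (pi\<^sup>2 * (of_int (- (2 * int i + 1)))\<^sup>2) =
         8 / pi\<^sup>2 * (1 / (real (2*i+1))\<^sup>2)"
      unfolding * r_def[symmetric] by simp
  qed simp
  also have "\<dots> \<le> 8 / pi\<^sup>2 * (pi\<^sup>2 / 8)"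
    by (intro mult_left_mono sum_inverse_odd_squares) auto
  finally show ?thesis by simp
qed

text \<open>The coefficients are of order \<open>1 / k\<close>, so every exponent above
  \<open>1\<close> gives a bound independent of \<open>J\<close>. An exponent below \<open>2\<close>
  is wanted, so that coefficients below a threshold carry little energy; \<open>3/2\<close>
  satisfies both.\<close>

lemma square_coeff_three_halves:
  obtains A where "A \<ge> 1" "\<And>J. (\<Sum>k\<in>{- 2 * int J..2 * int J}. cmod (square_coeff J k) powr (3/2)) \<le> A"
proof
  define f where "f n = real n powr (-3/2)" for n
  have sf: "summable f" unfolding f_def by (subst summable_real_powr_iff) simp
  define A where "A = 1 + 2 * suminf f"
  have sf0: "suminf f \<ge> 0" by (rule suminf_nonneg[OF sf]) (simp add: f_def)
  show "A \<ge> 1" using sf0 by (simp add: A_def)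
  fix J
  have "(\<Sum>k\<in>{- 2 * int J..2 * int J}. cmod (square_coeff J k) powr (3/2))
    = (\<Sum>k\<in>{- 2 * int J..2 * int J}. if odd k \<and> \<bar>k\<bar> < 2 * int J then (2 / (pi * of_int \<bar>k\<bar>)) powr (3/2) else 0)"
    by (rule sum.cong) (auto simp: square_coeff_def norm_divide norm_mult)
  also have "\<dots> = (\<Sum>i<J. 2 * (2 / (pi * real (2*i+1))) powr (3/2))"
    unfolding sum_odd_symmetric by (rule sum.cong) (auto simp: algebra_simps)
  also have "\<dots> \<le> (\<Sum>i<J. 2 * f (2*i+1))"
  proof (intro sum_mono mult_left_mono)
    fix i
    have "2 / (pi * real (2*i+1)) \<le> 1 / real (2*i+1)"
    proof -
      have "2 * real (2*i+1) \<le> pi * real (2*i+1)"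
        using pi_ge_two by (intro mult_right_mono) auto
      then show ?thesis by (simp add: divide_simps)
    qed
    then have "(2 / (pi * real (2*i+1))) powr (3/2) \<le> (1 / real (2*i+1)) powr (3/2)"
      by (intro powr_mono2) auto
    also have "\<dots> = f (2*i+1)"
      unfolding f_def by (simp add: powr_divide powr_minus_divide)
    finally show "(2 / (pi * real (2*i+1))) powr (3/2) \<le> f (2*i+1)" .
  qed auto
  also have "\<dots> = 2 * sum f ((\<lambda>i. 2*i+1) ` {..<J})"
    by (subst sum.reindex) (auto simp: inj_on_def sum_distrib_left)
  also have "sum f ((\<lambda>i. 2*i+1) ` {..<J}) \<le> suminf f"
    by (rule sum_le_suminf[OF sf]) (auto simp: f_def)
  finally show "(\<Sum>k\<in>{- 2 * int J..2 * int J}. cmod (square_coeff J k) powr (3/2)) \<le> A"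
    by (simp add: A_def)
qed

subsection \<open>Signs along the paths of a binary tree\<close>

text \<open>A node is the list of turns leading to it from the root, so \<open>v ! length u\<close>
  is the turn taken at the ancestor \<open>u\<close>. The assignment \<open>s\<close> singles out
  one path, which turns at each node according to the sign there.\<close>

definition consistent :: "(bool list \<Rightarrow> bool) \<Rightarrow> bool list \<Rightarrow> bool" where
  "consistent s v \<longleftrightarrow> (\<forall>u. strict_prefix u v \<longrightarrow> v ! length u = s u)"

definition node_sign :: "(bool list \<Rightarrow> bool) \<Rightarrow> bool list \<Rightarrow> real" where
  "node_sign s v = (if consistent s v then if s v then 1 else - 1 else 0)"

text \<open>The first argument counts levels. The \<open>True\<close> subtree comes first, so the
  rest of the path lies before a node with value \<open>1\<close> and after a node with value
  \<open>-1\<close>; this separates the two values.\<close>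

fun inorder :: "nat \<Rightarrow> bool list \<Rightarrow> bool list list" where
  "inorder 0 v = []"
| "inorder (Suc m) v = inorder m (v @ [True]) @ v # inorder m (v @ [False])"

lemma consistent_Nil [simp]: "consistent s []"
  by (simp add: consistent_def)

lemma consistent_snoc: "consistent s (v @ [b]) \<longleftrightarrow> consistent s v \<and> b = s v"
proof -
  have "strict_prefix u (v @ [b]) \<longleftrightarrow> strict_prefix u v \<or> u = v" for u
    by (auto simp: strict_prefix_def)
  then show ?thesis
    unfolding consistent_def by (auto simp: nth_append dest: prefix_length_less)
qed

lemma consistent_append: "consistent s (v @ w) \<Longrightarrow> consistent s v"
proof (induction w rule: rev_induct)
  case (snoc b w)
  then show ?case by (metis append_assoc consistent_snoc)
qed simp

lemma set_inorder: "set (inorder m v) = {v @ w |w. length w < m}"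
proof (induction m arbitrary: v)
  case (Suc m)
  have "{v @ w |w. length w < Suc m} = {(v @ [True]) @ w |w. length w < m} \<union> {v} \<union> {(v @ [False]) @ w |w. length w < m}"
  proof (intro subset_antisym subsetI)
    fix x assume "x \<in> {v @ w |w. length w < Suc m}"
    then obtain w where w: "x = v @ w" "length w < Suc m" by auto
    show "x \<in> {(v @ [True]) @ w |w. length w < m} \<union> {v} \<union> {(v @ [False]) @ w |w. length w < m}"
    proof (cases w)
      case (Cons b w')
      then show ?thesis using w by (cases b) auto
    qed (use w in auto)
  next
    fix x assume "x \<in> {(v @ [True]) @ w |w. length w < m} \<union> {v} \<union> {(v @ [False]) @ w |w. length w < m}"
    then consider w where "x = v @ True # w" "length w < m" | "x = v @ []" | w where "x = v @ False # w" "length w < m"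
      by auto
    then show "x \<in> {v @ w |w. length w < Suc m}"
    proof cases
      case 1 then show ?thesis by (intro CollectI exI[of _ "True # w"]) simp
    next
      case 2 then show ?thesis by (intro CollectI exI[of _ "[]"]) simp
    next
      case 3 then show ?thesis by (intro CollectI exI[of _ "False # w"]) simp
    qed
  qed
  then show ?case using Suc by auto
qed simp

lemma length_inorder: "length (inorder m v) = 2 ^ m - 1"
  by (induction m arbitrary: v) auto

lemma distinct_inorder: "distinct (inorder m v)"
proof (induction m arbitrary: v)
  case (Suc m)
  have "set (inorder m (v @ [True])) \<inter> set (inorder m (v @ [False])) = {}"
    by (auto simp: set_inorder)
  moreover have "v \<notin> set (inorder m (v @ [b]))" for b by (simp add: set_inorder)
  ultimately show ?case using Suc by simp
qed simp

lemma sum_list_inorder_inconsistent: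
  assumes "\<not> consistent s v"
  shows "sum_list (map (node_sign s) (inorder m v)) = 0"
proof -
  have "\<forall>u\<in>set (inorder m v). node_sign s u = 0"
    using assms consistent_append by (auto simp: set_inorder node_sign_def)
  then have "map (node_sign s) (inorder m v) = map (\<lambda>_. 0) (inorder m v)" by simp
  then show ?thesis by (simp only: sum_list_0)
qed

text \<open>The cut of the subtree entered by the path serves for the whole tree: \<open>v\<close>
  lies behind that subtree if its value is \<open>1\<close> and ahead of it if the value is
  \<open>-1\<close>, and so enlarges the difference by \<open>1\<close>. The other subtree is off
  the path and sums to \<open>0\<close>.\<close>

lemma inorder_split:
  assumes "consistent s v"
  shows "\<exists>xs ys. inorder m v = xs @ ys \<and>
    sum_list (map (node_sign s) ys) - sum_list (map (node_sign s) xs) = real m"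
  using assms
proof (induction m arbitrary: v)
  case (Suc m)
  have "consistent s (v @ [s v])" using Suc.prems by (simp add: consistent_snoc)
  from Suc.IH[OF this] obtain xs ys where xy: "inorder m (v @ [s v]) = xs @ ys"
      "sum_list (map (node_sign s) ys) - sum_list (map (node_sign s) xs) = real m"
    by blast
  have zero: "sum_list (map (node_sign s) (inorder m (v @ [\<not> s v]))) = 0"
    by (rule sum_list_inorder_inconsistent) (simp add: consistent_snoc)
  show ?case
  proof (cases "s v")
    case True
    have "inorder (Suc m) v = xs @ (ys @ v # inorder m (v @ [False]))"
      using True xy(1) by simp
    moreover have "sum_list (map (node_sign s) (ys @ v # inorder m (v @ [False])))
        = sum_list (map (node_sign s) ys) + 1"
      using True zero Suc.prems by (simp add: node_sign_def[of s v])
    moreover from this have "sum_list (map (node_sign s) (ys @ v # inorder m (v @ [False])))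
        - sum_list (map (node_sign s) xs) = real (Suc m)"
      using xy(2) by simp
    ultimately show ?thesis by blast
  next
    case False
    have "inorder (Suc m) v = (inorder m (v @ [True]) @ v # xs) @ ys"
      using False xy(1) by simp
    moreover have "sum_list (map (node_sign s) (inorder m (v @ [True]) @ v # xs))
        = sum_list (map (node_sign s) xs) - 1"
      using False zero Suc.prems by (simp add: node_sign_def[of s v])
    moreover from this have "sum_list (map (node_sign s) ys)
        - sum_list (map (node_sign s) (inorder m (v @ [True]) @ v # xs)) = real (Suc m)"
      using xy(2) by simp
    ultimately show ?thesis by blast
  qed
qed simp

text \<open>The function of node \<open>v\<close> as a product: when \<open>r u\<close> is a sign,
  \<open>(1 + r u) / 2\<close> or \<open>(1 - r u) / 2\<close> is the indicator of the turn made at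
  the ancestor \<open>u\<close>. The product form also makes sense for approximate signs, and it
  makes sums over coefficients multiplicative.\<close>

definition node_factor :: "(bool list \<Rightarrow> 'a::field) \<Rightarrow> bool list \<Rightarrow> bool list \<Rightarrow> 'a" where
  "node_factor r v u = (if u = v then r u
     else if strict_prefix u v then (1 + (if v ! length u then 1 else - 1) * r u) / 2 else 1)"

lemma prod_node_factor:
  assumes U: "finite U" "v \<in> U" "\<And>u. strict_prefix u v \<Longrightarrow> u \<in> U"
    and r: "\<And>u. u \<in> U \<Longrightarrow> r u = (if s u then 1 else - 1)"
  shows "(\<Prod>u\<in>U. node_factor r v u) = node_sign s v"
proof (cases "consistent s v")
  case True
  have "(\<Prod>u\<in>U. node_factor r v u) = (\<Prod>u\<in>U. if u = v then r v else 1)"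
    using True r by (intro prod.cong) (auto simp: node_factor_def consistent_def)
  also have "\<dots> = r v" using U by simp
  finally show ?thesis using True r U by (simp add: node_sign_def)
next
  case False
  then obtain u where u: "strict_prefix u v" "v ! length u \<noteq> s u" by (auto simp: consistent_def)
  then have "node_factor r v u = 0" using r U by (auto simp: node_factor_def)
  then have "(\<Prod>u\<in>U. node_factor r v u) = 0" using u U by (intro prod_zero) auto
  then show ?thesis using False by (simp add: node_sign_def)
qed

lemma norm_prod_diff_le:
  fixes a b :: "'i \<Rightarrow> 'a::{real_normed_field}"
  assumes "finite U" "\<And>u. u \<in> U \<Longrightarrow> norm (a u - b u) \<le> \<eta>" "\<And>u. u \<in> U \<Longrightarrow> norm (b u) \<le> 1" "\<eta> \<ge> 0"
  shows "norm (prod a U - prod b U) \<le> (1 + \<eta>) ^ card U - 1"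
  using assms
proof (induction U rule: finite_induct)
  case (insert x U)
  have ax: "norm (a x) \<le> 1 + \<eta>"
    using norm_triangle_ineq[of "a x - b x" "b x"] insert.prems(1)[of x] insert.prems(2)[of x] by simp
  have b1: "norm (prod b U) \<le> 1"
    unfolding prod_norm[symmetric] using insert.prems by (intro prod_le_1) auto
  have IH: "norm (prod a U - prod b U) \<le> (1 + \<eta>) ^ card U - 1" using insert by auto
  have "a x * prod a U - b x * prod b U = a x * (prod a U - prod b U) + (a x - b x) * prod b U"
    by (simp add: algebra_simps)
  then have "norm (a x * prod a U - b x * prod b U) \<le> norm (a x) * norm (prod a U - prod b U) + norm (a x - b x) * norm (prod b U)"
    by (metis norm_mult norm_triangle_ineq)
  also have "\<dots> \<le> (1 + \<eta>) * ((1 + \<eta>) ^ card U - 1) + \<eta> * 1"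
    using ax b1 IH insert.prems by (intro add_mono mult_mono) auto
  finally show ?case using insert by (simp add: algebra_simps)
qed simp

text \<open>Positional notation: the new weight \<open>M\<close> exceeds any difference of two sums
  over the old nodes, so a sum determines the digit at \<open>x\<close> first and then, inductively,
  the others. Distinct digit vectors thus get distinct frequencies.\<close>

lemma exists_lacunary_weights:
  assumes "finite U"
  shows "\<exists>m :: 'a \<Rightarrow> int. (\<forall>u\<in>U. m u > 0) \<and> inj_on (\<lambda>d. \<Sum>u\<in>U. d u * m u) (U \<rightarrow>\<^sub>E {- Q..Q})"
  using assms
proof (induction U rule: finite_induct)
  case (insert x U)
  then obtain m where m: "\<forall>u\<in>U. m u > 0" "inj_on (\<lambda>d. \<Sum>u\<in>U. d u * m u) (U \<rightarrow>\<^sub>E {- Q..Q})" by blast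
  define M where "M = 2 * \<bar>Q\<bar> * (\<Sum>u\<in>U. m u) + 1"
  define m' where "m' = m(x := M)"
  have M0: "M > 0" using m(1) by (simp add: M_def sum_nonneg less_imp_le zero_le_mult_iff add.commute add_pos_nonneg)
  have s: "(\<Sum>u\<in>insert x U. d u * m' u) = d x * M + (\<Sum>u\<in>U. restrict d U u * m u)" for d :: "'a \<Rightarrow> int"
  proof -
    have "(\<Sum>u\<in>U. d u * m' u) = (\<Sum>u\<in>U. restrict d U u * m u)"
      using insert by (intro sum.cong) (auto simp: m'_def)
    then show ?thesis using insert by (simp add: m'_def)
  qed
  have "inj_on (\<lambda>d. \<Sum>u\<in>insert x U. d u * m' u) (insert x U \<rightarrow>\<^sub>E {- Q..Q})"
  proof (rule inj_onI)
    fix d d' assume dd: "d \<in> insert x U \<rightarrow>\<^sub>E {- Q..Q}" "d' \<in> insert x U \<rightarrow>\<^sub>E {- Q..Q}"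
      and eq: "(\<Sum>u\<in>insert x U. d u * m' u) = (\<Sum>u\<in>insert x U. d' u * m' u)"
    have "\<bar>d u - d' u\<bar> \<le> 2 * \<bar>Q\<bar>" if "u \<in> U" for u
    proof -
      have "d u \<in> {-Q..Q}" "d' u \<in> {-Q..Q}" using dd that by auto
      then show ?thesis by auto
    qed
    then have "\<bar>\<Sum>u\<in>U. (d' u - d u) * m u\<bar> \<le> (\<Sum>u\<in>U. 2 * \<bar>Q\<bar> * m u)"
      using m(1) by (intro order_trans[OF sum_abs] sum_mono) (auto simp: abs_mult abs_minus_commute intro!: mult_mono)
    then have small: "\<bar>\<Sum>u\<in>U. (d' u - d u) * m u\<bar> < M" by (simp add: M_def sum_distrib_left)
    have "(d x - d' x) * M = (\<Sum>u\<in>U. (d' u - d u) * m u)"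
      using eq unfolding s by (simp add: left_diff_distrib sum_subtractf)
    then have "\<bar>d x - d' x\<bar> * M < 1 * M" using small M0 by (metis abs_mult abs_of_pos mult_1)
    then have x: "d x = d' x" using M0 by simp
    then have "restrict d U = restrict d' U"
      using eq unfolding s using dd by (intro inj_onD[OF m(2)]) auto
    then show "d = d'" using x dd by (intro PiE_ext[OF dd]) (metis insertE restrict_apply')
  qed
  then show ?case using m(1) M0 by (intro exI[of _ m']) (auto simp: m'_def)
qed simp

subsection \<open>Trigonometric sums on the unit interval\<close>

lemma trig_system_cis: "trig_system n x = cis (2 * pi * real n * x)"
  unfolding trig_system_def cis_conv_exp by (simp add: algebra_simps)

lemma norm_trig_system [simp]: "cmod (trig_system n x) = 1"
  by (simp add: trig_system_cis)

lemma trig_system_add: "trig_system (m + n) x = trig_system m x * trig_system n x"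
  by (simp add: trig_system_cis cis_mult algebra_simps)

lemma continuous_on_trig_system [continuous_intros]: "continuous_on S (trig_system n)"
  unfolding trig_system_def by (intro continuous_intros)

lemma borel_measurable_trig_system [measurable]:
  "trig_system n \<in> borel_measurable (lebesgue_on {0<..<1})"
  by (rule continuous_imp_measurable_on_sets_lebesgue[OF continuous_on_trig_system]) auto

lemma trig_parseval:
  fixes c :: "'d \<Rightarrow> complex" and f :: "'d \<Rightarrow> nat"
  assumes D: "finite D" "inj_on f D" "\<And>d. d \<in> D \<Longrightarrow> f d \<ge> 1"
  shows "integrable (lebesgue_on {0<..<1}) (\<lambda>x. (cmod (\<Sum>d\<in>D. c d * trig_system (f d) x))\<^sup>2)"
    and "(LINT x|lebesgue_on {0<..<1}. (cmod (\<Sum>d\<in>D. c d * trig_system (f d) x))\<^sup>2) = (\<Sum>d\<in>D. (cmod (c d))\<^sup>2)"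
proof -
  let ?M = "lebesgue_on {0<..<1::real}"
  interpret finite_measure ?M by (rule finite_measure_lebesgue_on) auto
  define T where "T d e x = c d * cnj (c e) * (trig_system (f d) x * cnj (trig_system (f e) x))" for d e x
  have cnj_eq: "cnj (trig_system k x) = cis (- (2 * pi * real k * x))" for k x
    by (simp add: trig_system_cis cis_cnj)
  have meas: "(\<lambda>x. cnj (trig_system k x)) \<in> borel_measurable ?M" for k
    unfolding cnj_eq
    by (rule continuous_imp_measurable_on_sets_lebesgue) (auto intro!: continuous_intros)
  have int: "integrable ?M (T d e)" for d e
    unfolding T_def
    by (rule integrable_const_bound[where B = "cmod (c d) * cmod (c e)"])
       (use meas in \<open>auto simp: norm_mult\<close>)
  have eq: "complex_of_real ((cmod (\<Sum>d\<in>D. c d * trig_system (f d) x))\<^sup>2) = (\<Sum>d\<in>D. \<Sum>e\<in>D. T d e x)" for x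
    unfolding complex_norm_square T_def cnj_sum sum_product
    by (intro sum.cong refl) (simp add: mult_ac)
  have "integrable ?M (\<lambda>x. \<Sum>d\<in>D. \<Sum>e\<in>D. T d e x)"
    by (intro Bochner_Integration.integrable_sum int)
  then have "integrable ?M (\<lambda>x. complex_of_real ((cmod (\<Sum>d\<in>D. c d * trig_system (f d) x))\<^sup>2))"
    by (simp only: eq)
  then show "integrable ?M (\<lambda>x. (cmod (\<Sum>d\<in>D. c d * trig_system (f d) x))\<^sup>2)"
    by (simp only: complex_of_real_integrable_eq)
  have orth: "(LINT x|?M. T d e x) = c d * cnj (c e) * of_bool (d = e)" if "d \<in> D" "e \<in> D" for d e
  proof -
    have "(LINT x|?M. trig_system (f d) x * cnj (trig_system (f e) x)) = of_bool (f d = f e)"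
      using orthonormal_system_trig_system D(3) that unfolding orthonormal_system_def by blast
    moreover have "f d = f e \<longleftrightarrow> d = e" using D(2) that by (auto dest: inj_onD)
    ultimately show ?thesis unfolding T_def by simp
  qed
  have "complex_of_real (LINT x|?M. (cmod (\<Sum>d\<in>D. c d * trig_system (f d) x))\<^sup>2)
      = (LINT x|?M. (\<Sum>d\<in>D. \<Sum>e\<in>D. T d e x))"
    by (simp only: integral_complex_of_real[symmetric] eq)
  also have "\<dots> = (\<Sum>d\<in>D. \<Sum>e\<in>D. (LINT x|?M. T d e x))"
    by (simp add: Bochner_Integration.integral_sum Bochner_Integration.integrable_sum int)
  also have "\<dots> = (\<Sum>d\<in>D. \<Sum>e\<in>D. c d * cnj (c e) * of_bool (d = e))"
    by (intro sum.cong refl orth)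
  also have "\<dots> = (\<Sum>d\<in>D. c d * cnj (c d))"
    using D(1) by (intro sum.cong refl) (simp add: of_bool_def if_distrib sum.delta cong: if_cong)
  also have "\<dots> = complex_of_real (\<Sum>d\<in>D. (cmod (c d))\<^sup>2)"
    by (simp only: complex_norm_square of_real_sum)
  finally show "(LINT x|?M. (cmod (\<Sum>d\<in>D. c d * trig_system (f d) x))\<^sup>2) = (\<Sum>d\<in>D. (cmod (c d))\<^sup>2)"
    by (simp only: of_real_eq_iff)
qed

lemma trig_chebyshev:
  fixes c :: "'d \<Rightarrow> complex" and f :: "'d \<Rightarrow> nat"
  assumes D: "finite D" "inj_on f D" "\<And>d. d \<in> D \<Longrightarrow> f d \<ge> 1" and \<delta>: "\<delta> > 0"
  defines "B \<equiv> {x\<in>{0<..<1}. cmod (\<Sum>d\<in>D. c d * trig_system (f d) x) \<ge> \<delta>}"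
  shows "B \<in> sets (lebesgue_on {0<..<1})"
    and "measure (lebesgue_on {0<..<1}) B \<le> (\<Sum>d\<in>D. (cmod (c d))\<^sup>2) / \<delta>\<^sup>2"
proof -
  let ?M = "lebesgue_on {0<..<1::real}"
  have B: "B = {x\<in>space ?M. (cmod (\<Sum>d\<in>D. c d * trig_system (f d) x))\<^sup>2 \<ge> \<delta>\<^sup>2}"
    unfolding B_def using \<delta> by (auto simp: space_restrict_space power2_le_iff_abs_le)
  show "B \<in> sets ?M" unfolding B by measurable
  have "measure ?M B \<le> (LINT x|?M. (cmod (\<Sum>d\<in>D. c d * trig_system (f d) x))\<^sup>2) / \<delta>\<^sup>2"
    unfolding B by (rule integral_Markov_inequality_measure[OF trig_parseval(1)[OF D], of "{}"]) (use \<delta> in auto)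
  then show "measure ?M B \<le> (\<Sum>d\<in>D. (cmod (c d))\<^sup>2) / \<delta>\<^sup>2"
    using trig_parseval(2)[OF D] by simp
qed

text \<open>\<open>sin (2 * pi * m * x)\<close> vanishes exactly where \<open>2 * m * x\<close> is
  an integer.\<close>

definition near_zeros :: "int \<Rightarrow> real \<Rightarrow> real set" where
  "near_zeros m \<epsilon> = {x\<in>{0<..<1}. \<exists>k::int. \<bar>2 * of_int m * x - of_int k\<bar> < \<epsilon>}"

text \<open>At most \<open>2 * m + 1\<close> integers \<open>k\<close> matter, each with an interval
  of length \<open>\<epsilon> / m\<close>, so the bound does not depend on \<open>m\<close>.\<close>

lemma near_zeros_measure:
  assumes m: "m > 0" and \<epsilon>: "0 < \<epsilon>" "\<epsilon> \<le> 1/2"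
  shows "near_zeros m \<epsilon> \<in> sets (lebesgue_on {0<..<1})"
    and "measure (lebesgue_on {0<..<1}) (near_zeros m \<epsilon>) \<le> 3 * \<epsilon>"
proof -
  define I where "I k = {(of_int k - \<epsilon>) / (2 * of_int m)<..<(of_int k + \<epsilon>) / (2 * of_int m)}" for k :: int
  have I: "x \<in> I k \<longleftrightarrow> \<bar>2 * of_int m * x - of_int k\<bar> < \<epsilon>" for x k
    using m by (auto simp: I_def abs_less_iff field_simps)
  have eq: "near_zeros m \<epsilon> = {0<..<1} \<inter> (\<Union>k. I k)"
    by (auto simp: near_zeros_def I)
  have "open (near_zeros m \<epsilon>)" unfolding eq by (intro open_Int open_UN ballI) (auto simp: I_def)
  then have sets: "near_zeros m \<epsilon> \<in> sets lebesgue" by auto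
  then show "near_zeros m \<epsilon> \<in> sets (lebesgue_on {0<..<1})"
    by (simp add: sets_restrict_space_iff eq)
  have sub: "near_zeros m \<epsilon> \<subseteq> (\<Union>k\<in>{0..2*m}. I k)"
  proof
    fix x assume "x \<in> near_zeros m \<epsilon>"
    then obtain k where x: "0 < x" "x < 1" and k: "\<bar>2 * of_int m * x - of_int k\<bar> < \<epsilon>"
      by (auto simp: near_zeros_def)
    have "0 < 2 * of_int m * x" "2 * of_int m * x < 2 * of_int m * 1"
      using x m by auto
    then have "real_of_int k > -1" "real_of_int k < 2 * of_int m + 1" using k \<epsilon> by linarith+
    then have "k \<in> {0..2*m}" by (auto simp flip: of_int_less_iff)
    then show "x \<in> (\<Union>k\<in>{0..2*m}. I k)" using k I by blast
  qed
  have lm: "I k \<in> lmeasurable" for k by (simp add: I_def)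
  have mI: "measure lebesgue (I k) = \<epsilon> / of_int m" for k
    using m \<epsilon> by (simp add: I_def divide_right_mono diff_divide_distrib[symmetric])
  have "measure (lebesgue_on {0<..<1}) (near_zeros m \<epsilon>) = measure lebesgue (near_zeros m \<epsilon>)"
    by (rule measure_restrict_space) (auto simp: eq)
  also have "\<dots> \<le> measure lebesgue (\<Union>k\<in>{0..2*m}. I k)"
    by (rule measure_mono_fmeasurable[OF sub sets]) (auto intro!: fmeasurable.finite_UN lm)
  also have "\<dots> \<le> (\<Sum>k\<in>{0..2*m}. measure lebesgue (I k))"
    by (rule measure_UNION_le) (use lm in auto)
  also have "\<dots> = (2 * of_int m + 1) * \<epsilon> / of_int m" using m by (simp add: mI)
  also have "\<dots> \<le> 3 * \<epsilon>"
  proof -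
    have "(2 * of_int m + 1) * \<epsilon> \<le> (3 * of_int m) * \<epsilon>"
      using m \<epsilon> by (intro mult_right_mono) auto
    then show ?thesis using m by (simp add: divide_le_eq mult_ac)
  qed
  finally show "measure (lebesgue_on {0<..<1}) (near_zeros m \<epsilon>) \<le> 3 * \<epsilon>" .
qed

text \<open>The fractional part of \<open>2 * m * x\<close> lies between \<open>\<epsilon>\<close>
  and \<open>1 - \<epsilon>\<close>, and dropping the integer part changes the sine at most by its
  sign.\<close>

lemma sin_ge_outside_near_zeros:
  assumes x: "x \<in> {0<..<1} - near_zeros m \<epsilon>" and \<epsilon>: "0 < \<epsilon>" "\<epsilon> \<le> 1/2"
  shows "\<bar>sin (2 * pi * of_int m * x)\<bar> \<ge> sin (pi * \<epsilon>)"
proof -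
  define y where "y = 2 * of_int m * x"
  define k where "k = \<lfloor>y\<rfloor>"
  define f where "f = y - of_int k"
  have ge: "\<epsilon> \<le> \<bar>y - of_int j\<bar>" for j :: int
    using x unfolding near_zeros_def y_def not_less[symmetric] by blast
  have f01: "0 \<le> f" "f < 1" unfolding f_def k_def by linarith+
  have f: "\<epsilon> \<le> f" "f \<le> 1 - \<epsilon>" using ge[of k] ge[of "k + 1"] f01 by (auto simp: f_def)
  have mono: "sin (pi * \<epsilon>) \<le> sin (pi * g)" if "\<epsilon> \<le> g" "g \<le> 1/2" for g
  proof (rule sin_monotone_2pi_le)
    show "- (pi / 2) \<le> pi * \<epsilon>" by (rule order_trans[of _ 0]) (use \<epsilon> in auto)
  qed (use that in auto)
  have "sin (pi * \<epsilon>) \<le> sin (pi * f)"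
  proof (cases "f \<le> 1/2")
    case False
    then have "sin (pi * \<epsilon>) \<le> sin (pi * (1 - f))" using f by (intro mono) auto
    then show ?thesis by (simp add: right_diff_distrib)
  qed (use mono f in auto)
  moreover have "sin (2 * pi * of_int m * x) = sin (pi * f + pi * of_int k)"
    by (simp add: f_def y_def algebra_simps)
  moreover have "\<bar>sin (pi * f + pi * of_int k)\<bar> = \<bar>sin (pi * f)\<bar>"
  proof -
    have s0: "sin (pi * of_int k) = 0" using sin_zero_iff_int2[of "pi * of_int k"] by (auto simp: mult.commute)
    then have "\<bar>cos (pi * of_int k)\<bar> = 1" using sin_cos_squared_add[of "pi * of_int k"] by (simp add: power2_eq_1_iff)
    then show ?thesis by (simp add: sin_add s0 abs_mult)
  qed
  ultimately show ?thesis by linarith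
qed

subsection \<open>Coefficients of the tree products\<close>

text \<open>Fourier coefficients of \<open>node_factor\<close> at \<open>u\<close> with the square
  wave in place of \<open>r\<close>; the constant \<open>1\<close> becomes
  \<open>of_bool (k = 0)\<close>.\<close>

definition node_coeff :: "nat \<Rightarrow> bool list \<Rightarrow> bool list \<Rightarrow> int \<Rightarrow> complex" where
  "node_coeff J v u k = (if u = v then square_coeff J k
     else if strict_prefix u v then (of_bool (k = 0) + (if v ! length u then 1 else - 1) * square_coeff J k) / 2
     else of_bool (k = 0))"

lemma square_coeff_0 [simp]: "square_coeff J 0 = 0"
  by (simp add: square_coeff_def)

lemma node_coeff_fourier:
  "(\<Sum>k\<in>{- 2 * int J..2 * int J}. node_coeff J v u k * cis (of_int k * \<theta>))
    = node_factor (\<lambda>_. of_real (square_wave J \<theta>)) v u"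
proof -
  let ?K = "{- 2 * int J..2 * int J}"
  have one: "(\<Sum>k\<in>?K. of_bool (k = 0) * cis (of_int k * \<theta>)) = 1"
  proof -
    have "(\<Sum>k\<in>?K. of_bool (k = 0) * cis (of_int k * \<theta>)) = (\<Sum>k\<in>?K. if k = 0 then 1 else 0)"
      by (rule sum.cong) auto
    then show ?thesis by (simp add: sum.delta)
  qed
  define b :: complex where "b = (if v ! length u then 1 else - 1)"
  have "(\<Sum>k\<in>?K. (of_bool (k = 0) + b * square_coeff J k) / 2 * cis (of_int k * \<theta>))
      = ((\<Sum>k\<in>?K. of_bool (k = 0) * cis (of_int k * \<theta>))
          + b * (\<Sum>k\<in>?K. square_coeff J k * cis (of_int k * \<theta>))) / 2"
    unfolding sum_distrib_left sum.distrib[symmetric] sum_divide_distrib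
    by (rule sum.cong) (auto simp: algebra_simps add_divide_distrib)
  then have "(\<Sum>k\<in>?K. (of_bool (k = 0) + b * square_coeff J k) / 2 * cis (of_int k * \<theta>))
      = (1 + b * of_real (square_wave J \<theta>)) / 2"
    unfolding one square_wave_fourier .
  then show ?thesis
    unfolding node_coeff_def node_factor_def b_def
    by (cases "u = v"; cases "strict_prefix u v") (simp_all only: simp_thms if_True if_False square_wave_fourier one)
qed

text \<open>At an ancestor, the constant and the square wave use different frequencies, as
  \<open>square_coeff J 0 = 0\<close>; their energies add up to at most \<open>1/4 + 1/4\<close>.
  This halving compensates for the doubling of the number of nodes from level to level.\<close>

lemma node_coeff_energy:
  "(\<Sum>k\<in>{- 2 * int J..2 * int J}. (cmod (node_coeff J v u k))\<^sup>2) \<le> (if strict_prefix u v then 1/2 else 1)"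
proof -
  let ?K = "{- 2 * int J..2 * int J}"
  have one: "(\<Sum>k\<in>?K. (of_bool (k = 0) :: real)) = 1"
    by (simp add: of_bool_def sum.delta)
  consider "u = v" | "strict_prefix u v" "u \<noteq> v" | "u \<noteq> v" "\<not> strict_prefix u v" by blast
  then show ?thesis
  proof cases
    case 1
    then show ?thesis using square_coeff_energy[of J] by (simp add: node_coeff_def)
  next
    case 2
    have "(\<Sum>k\<in>?K. (cmod (node_coeff J v u k))\<^sup>2)
        = (\<Sum>k\<in>?K. of_bool (k = 0) / 4 + (cmod (square_coeff J k))\<^sup>2 / 4)"
      using 2 by (intro sum.cong refl) (auto simp: node_coeff_def norm_divide power_divide)
    also have "\<dots> = ((\<Sum>k\<in>?K. of_bool (k = 0)) + (\<Sum>k\<in>?K. (cmod (square_coeff J k))\<^sup>2)) / 4"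
      by (simp only: sum.distrib sum_divide_distrib[symmetric] add_divide_distrib)
    also have "\<dots> \<le> 1/2" unfolding one using square_coeff_energy[of J] by simp
    finally show ?thesis using 2 by simp
  next
    case 3
    then have "(\<Sum>k\<in>?K. (cmod (node_coeff J v u k))\<^sup>2) = (\<Sum>k\<in>?K. of_bool (k = 0))"
      by (intro sum.cong refl) (auto simp: node_coeff_def)
    then show ?thesis using 3 one by simp
  qed
qed

lemma node_coeff_three_halves:
  assumes A: "\<And>J. (\<Sum>k\<in>{- 2 * int J..2 * int J}. cmod (square_coeff J k) powr (3/2)) \<le> A" "A \<ge> 0"
  shows "(\<Sum>k\<in>{- 2 * int J..2 * int J}. cmod (node_coeff J v u k) powr (3/2))
    \<le> (if prefix u v then 1 + A else 1)"
proof -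
  let ?K = "{- 2 * int J..2 * int J}"
  have one: "(\<Sum>k\<in>?K. (of_bool (k = 0) :: real)) = 1"
    by (simp add: of_bool_def sum.delta)
  consider "u = v" | "strict_prefix u v" "u \<noteq> v" | "u \<noteq> v" "\<not> strict_prefix u v" by blast
  then show ?thesis
  proof cases
    case 1
    then show ?thesis using A(1)[of J] A(2) by (simp add: node_coeff_def)
  next
    case 2
    have "(\<Sum>k\<in>?K. cmod (node_coeff J v u k) powr (3/2))
        \<le> (\<Sum>k\<in>?K. of_bool (k = 0) + cmod (square_coeff J k) powr (3/2))"
    proof (intro sum_mono)
      fix k
      show "cmod (node_coeff J v u k) powr (3/2) \<le> of_bool (k = 0) + cmod (square_coeff J k) powr (3/2)"
      proof (cases "k = 0")
        case True
        have "(1/2::real) powr (3/2) \<le> 1" by (intro powr_le1) auto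
        then show ?thesis using 2 True by (simp add: node_coeff_def)
      next
        case False
        have "(cmod (square_coeff J k) / 2) powr (3/2) \<le> cmod (square_coeff J k) powr (3/2)"
          by (intro powr_mono2) auto
        then show ?thesis using 2 False by (simp add: node_coeff_def norm_divide norm_mult)
      qed
    qed
    also have "\<dots> \<le> 1 + A" using A(1)[of J] one by (simp add: sum.distrib)
    finally show ?thesis using 2 by (simp add: strict_prefix_def)
  next
    case 3
    have "(\<Sum>k\<in>?K. cmod (node_coeff J v u k) powr (3/2)) = (\<Sum>k\<in>?K. of_bool (k = 0))"
      using 3 by (intro sum.cong refl) (auto simp: node_coeff_def)
    then show ?thesis using 3 one A by simp
  qed
qed

text \<open>Multiplying out the product over \<open>U\<close> picks one multiple \<open>d u\<close>
  of the frequency of each node; this is the coefficient of that choice.\<close>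

definition tree_coeff :: "nat \<Rightarrow> bool list set \<Rightarrow> bool list \<Rightarrow> (bool list \<Rightarrow> int) \<Rightarrow> complex" where
  "tree_coeff J U v d = (\<Prod>u\<in>U. node_coeff J v u (d u))"

abbreviation digits :: "nat \<Rightarrow> bool list set \<Rightarrow> (bool list \<Rightarrow> int) set" where
  "digits J U \<equiv> U \<rightarrow>\<^sub>E {- 2 * int J..2 * int J}"

lemma cis_sum: "finite S \<Longrightarrow> cis (\<Sum>i\<in>S. f i) = (\<Prod>i\<in>S. cis (f i))"
  by (induction S rule: finite_induct) (simp_all add: cis_mult flip: cis_mult)

lemma tree_coeff_fourier:
  assumes "finite U"
  shows "(\<Sum>d\<in>digits J U. tree_coeff J U v d * cis (\<Sum>u\<in>U. of_int (d u) * \<theta> u))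
    = (\<Prod>u\<in>U. node_factor (\<lambda>u. of_real (square_wave J (\<theta> u))) v u)"
proof -
  have "(\<Prod>u\<in>U. node_factor (\<lambda>u. of_real (square_wave J (\<theta> u))) v u)
      = (\<Prod>u\<in>U. \<Sum>k\<in>{- 2 * int J..2 * int J}. node_coeff J v u k * cis (of_int k * \<theta> u))"
    unfolding node_coeff_fourier by (simp add: node_factor_def)
  also have "\<dots> = (\<Sum>d\<in>digits J U. \<Prod>u\<in>U. node_coeff J v u (d u) * cis (of_int (d u) * \<theta> u))"
    using assms by (intro prod_sum_PiE) auto
  also have "\<dots> = (\<Sum>d\<in>digits J U. tree_coeff J U v d * cis (\<Sum>u\<in>U. of_int (d u) * \<theta> u))"
    using assms by (simp add: prod.distrib tree_coeff_def cis_sum)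
  finally show ?thesis by simp
qed

lemma card_strict_prefixes: "card {u. strict_prefix u v} = length v"
proof -
  have "{u. strict_prefix u v} = (\<lambda>i. take i v) ` {..<length v}"
  proof (intro subset_antisym subsetI)
    fix u assume "u \<in> {u. strict_prefix u v}"
    then have "u = take (length u) v" "length u < length v"
      by (auto simp: strict_prefix_def prefix_def)
    then show "u \<in> (\<lambda>i. take i v) ` {..<length v}" by blast
  qed (auto simp: strict_prefix_def take_is_prefix)
  moreover have "inj_on (\<lambda>i. take i v) {..<length v}"
    by (rule inj_onI) (metis length_take lessThan_iff min.absorb4)
  ultimately show ?thesis by (simp add: card_image)
qed

text \<open>A sum over digit vectors factorizes into sums over single digits, where each of the
  \<open>length v\<close> proper ancestors contributes at most \<open>1/2\<close>.\<close>

lemma tree_coeff_energy: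
  assumes "finite U" "\<And>u. strict_prefix u v \<Longrightarrow> u \<in> U"
  shows "(\<Sum>d\<in>digits J U. (cmod (tree_coeff J U v d))\<^sup>2) \<le> (1/2) ^ length v"
proof -
  have "(\<Sum>d\<in>digits J U. (cmod (tree_coeff J U v d))\<^sup>2)
      = (\<Prod>u\<in>U. \<Sum>k\<in>{- 2 * int J..2 * int J}. (cmod (node_coeff J v u k))\<^sup>2)"
    using assms by (subst prod_sum_PiE) (auto simp: tree_coeff_def prod_norm[symmetric] prod_power_distrib)
  also have "\<dots> \<le> (\<Prod>u\<in>U. if strict_prefix u v then 1/2 else 1)"
    by (intro prod_mono conjI node_coeff_energy sum_nonneg) auto
  also have "\<dots> = (1/2) ^ card {u\<in>U. strict_prefix u v}"
    using assms by (simp add: prod.If_cases Int_def)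
  also have "{u\<in>U. strict_prefix u v} = {u. strict_prefix u v}" using assms by auto
  finally show ?thesis by (simp add: card_strict_prefixes)
qed

text \<open>The same factorization. Only the \<open>length v + 1\<close> prefixes of
  \<open>v\<close> can contribute more than \<open>1\<close>, so the bound is exponential in the
  depth although \<open>U\<close> may have exponentially many nodes, and it does not depend on
  \<open>J\<close>.\<close>

lemma tree_coeff_three_halves:
  assumes A: "\<And>J. (\<Sum>k\<in>{- 2 * int J..2 * int J}. cmod (square_coeff J k) powr (3/2)) \<le> A" "A \<ge> 0"
  assumes "finite U" "\<And>u. prefix u v \<Longrightarrow> u \<in> U"
  shows "(\<Sum>d\<in>digits J U. cmod (tree_coeff J U v d) powr (3/2)) \<le> (1 + A) ^ Suc (length v)"
proof -
  have "(\<Sum>d\<in>digits J U. cmod (tree_coeff J U v d) powr (3/2))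
      = (\<Prod>u\<in>U. \<Sum>k\<in>{- 2 * int J..2 * int J}. cmod (node_coeff J v u k) powr (3/2))"
    using assms by (subst prod_sum_PiE) (auto simp: tree_coeff_def prod_norm[symmetric] prod_powr_distrib)
  also have "\<dots> \<le> (\<Prod>u\<in>U. if prefix u v then 1 + A else 1)"
    by (intro prod_mono conjI node_coeff_three_halves A sum_nonneg) auto
  also have "\<dots> = (1 + A) ^ card {u\<in>U. prefix u v}"
    using assms by (simp add: prod.If_cases Int_def)
  also have "{u\<in>U. prefix u v} = insert v {u. strict_prefix u v}" using assms by (auto simp: strict_prefix_def)
  also have "card \<dots> = Suc (length v)"
  proof -
    have "finite {u. strict_prefix u v}"
      using assms by (intro finite_subset[OF _ assms(3)]) (auto simp: strict_prefix_def)
    then show ?thesis by (simp add: card_strict_prefixes)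
  qed
  finally show ?thesis .
qed

text \<open>A nonzero coefficient for \<open>v\<close> forces a nonzero digit at \<open>v\<close>,
  whereas a nonzero coefficient for \<open>w\<close> forces the digit at \<open>v\<close> to be
  \<open>0\<close> unless \<open>v\<close> is a prefix of \<open>w\<close>. By symmetry each is a
  prefix of the other.\<close>

lemma tree_coeff_disjoint:
  assumes "finite U" "v \<in> U" "w \<in> U" "tree_coeff J U v d \<noteq> 0" "tree_coeff J U w d \<noteq> 0"
  shows "v = w"
proof -
  have nz: "node_coeff J v u (d u) \<noteq> 0" "node_coeff J w u (d u) \<noteq> 0" if "u \<in> U" for u
    using assms that by (auto simp: tree_coeff_def)
  have *: "prefix v w" if "node_coeff J v v (d v) \<noteq> 0" "node_coeff J w v (d v) \<noteq> 0" for v w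
  proof (rule ccontr)
    assume "\<not> prefix v w"
    then have "d v = 0" using that by (auto simp: node_coeff_def strict_prefix_def split: if_splits)
    then show False using that by (simp add: node_coeff_def)
  qed
  show ?thesis using *[of v w] *[of w v] nz assms by (meson prefix_order.antisym)
qed

text \<open>The \<open>2 ^ j\<close> nodes at depth \<open>j\<close> below \<open>v\<close> carry
  \<open>(1/2) ^ (length v + j)\<close> each, so all levels contribute equally.\<close>

lemma sum_list_inorder_power: "(\<Sum>u\<leftarrow>inorder m v. (1/2::real) ^ length u) = real m * (1/2) ^ length v"
  by (induction m arbitrary: v) (auto simp: algebra_simps)

subsection \<open>Blocks with a large partial sum\<close>

text \<open>Write \<open>r\<^sup>2\<close> as \<open>r powr (1/2) * r powr (3/2)\<close> and bound
  the first factor by \<open>sqrt \<tau>\<close>.\<close>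

lemma small_coeffs_energy:
  fixes c :: "'d \<Rightarrow> complex"
  assumes "finite D" "\<tau> > 0"
  shows "(\<Sum>d | d \<in> D \<and> cmod (c d) < \<tau>. (cmod (c d))\<^sup>2) \<le> sqrt \<tau> * (\<Sum>d\<in>D. cmod (c d) powr (3/2))"
proof -
  have pt: "r\<^sup>2 \<le> sqrt \<tau> * r powr (3/2)" if "0 \<le> r" "r < \<tau>" for r :: real
  proof (cases "r = 0")
    case False
    then have "r\<^sup>2 = r powr (1/2) * r powr (3/2)"
      using that by (simp flip: powr_add powr_numeral)
    also have "\<dots> \<le> sqrt \<tau> * r powr (3/2)"
      using that by (intro mult_right_mono) (auto simp: powr_half_sqrt)
    finally show ?thesis .
  qed simp
  have "(\<Sum>d | d \<in> D \<and> cmod (c d) < \<tau>. (cmod (c d))\<^sup>2)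
      \<le> (\<Sum>d | d \<in> D \<and> cmod (c d) < \<tau>. sqrt \<tau> * cmod (c d) powr (3/2))"
    by (intro sum_mono pt) auto
  also have "\<dots> \<le> (\<Sum>d\<in>D. sqrt \<tau> * cmod (c d) powr (3/2))"
    using assms by (intro sum_mono2) auto
  finally show ?thesis by (simp add: sum_distrib_left)
qed

lemma card_large_coeffs:
  fixes c :: "'d \<Rightarrow> complex"
  assumes "finite D" "\<tau> > 0" "(\<Sum>d\<in>D. (cmod (c d))\<^sup>2) \<le> 1"
  shows "real (card {d\<in>D. \<tau> \<le> cmod (c d)}) \<le> 1 / \<tau>\<^sup>2"
proof -
  have "real (card {d\<in>D. \<tau> \<le> cmod (c d)}) * \<tau>\<^sup>2 = (\<Sum>d | d \<in> D \<and> \<tau> \<le> cmod (c d). \<tau>\<^sup>2)" by simp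
  also have "\<dots> \<le> (\<Sum>d | d \<in> D \<and> \<tau> \<le> cmod (c d). (cmod (c d))\<^sup>2)"
    using assms by (intro sum_mono power_mono) auto
  also have "\<dots> \<le> (\<Sum>d\<in>D. (cmod (c d))\<^sup>2)" using assms by (intro sum_mono2) auto
  finally show ?thesis using assms by (simp add: field_simps)
qed

lemma power_one_plus_le:
  fixes \<eta> :: real
  assumes "0 \<le> \<eta>" "\<eta> \<le> 1"
  shows "(1 + \<eta>) ^ N - 1 \<le> 2 ^ N * \<eta>"
proof (induction N)
  case (Suc N)
  have "(1 + \<eta>) ^ N \<le> 2 ^ N" using assms by (intro power_mono) auto
  then have "(1 + \<eta>) ^ N * \<eta> \<le> 2 ^ N * \<eta>" using assms by (intro mult_right_mono) auto
  then show ?case using Suc by (simp add: algebra_simps)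
qed (use assms in simp)

lemma sum_list_concat_map: "(\<Sum>p\<leftarrow>concat (map L Z). g p) = (\<Sum>v\<leftarrow>Z. \<Sum>p\<leftarrow>L v. g p)"
  for g :: "'a \<Rightarrow> 'b::comm_monoid_add"
  by (induction Z) auto

lemma length_concat_map: "real (length (concat (map L Z))) = (\<Sum>v\<leftarrow>Z. real (length (L v)))"
  by (induction Z) auto

lemma distinct_concat_map:
  assumes "distinct Z" "\<And>v. v \<in> set Z \<Longrightarrow> distinct (L v)"
    and "\<And>v w. v \<in> set Z \<Longrightarrow> w \<in> set Z \<Longrightarrow> v \<noteq> w \<Longrightarrow> set (L v) \<inter> set (L w) = {}"
  shows "distinct (concat (map L Z))"
  using assms
proof (induction Z)
  case (Cons v Z)
  have "set (L v) \<inter> set (concat (map L Z)) = {}"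
    using Cons.prems(1) Cons.prems(3)[of v] by fastforce
  then show ?case using Cons by simp
qed simp

lemma norm_sum_list_diff_le:
  fixes f g :: "'a \<Rightarrow> complex"
  assumes "\<And>v. v \<in> set Z \<Longrightarrow> cmod (f v - g v) \<le> e"
  shows "cmod ((\<Sum>v\<leftarrow>Z. f v) - (\<Sum>v\<leftarrow>Z. g v)) \<le> real (length Z) * e"
  using assms
proof (induction Z)
  case (Cons a Z)
  have "cmod ((f a - g a) + ((\<Sum>v\<leftarrow>Z. f v) - (\<Sum>v\<leftarrow>Z. g v))) \<le> e + real (length Z) * e"
    using Cons by (intro norm_triangle_mono) auto
  then show ?case by (simp add: algebra_simps)
qed simp

text \<open>Passage from signs to approximate signs \<open>r\<close>: each factor moves by at most
  \<open>\<eta>\<close>, and the factors with exact signs have modulus at most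
  \<open>1\<close>.\<close>

lemma tree_product_approx:
  assumes U: "finite U" "v \<in> U" "\<And>u. strict_prefix u v \<Longrightarrow> u \<in> U"
    and r: "\<And>u. u \<in> U \<Longrightarrow> \<bar>r u - (if s u then 1 else - 1)\<bar> \<le> \<eta>" and \<eta>: "0 \<le> \<eta>" "\<eta> \<le> 1"
  shows "cmod ((\<Prod>u\<in>U. node_factor (\<lambda>u. complex_of_real (r u)) v u) - of_real (node_sign s v)) \<le> 2 ^ card U * \<eta>"
proof -
  define b :: "bool list \<Rightarrow> real" where "b u = (if s u then 1 else - 1)" for u
  have pb: "(\<Prod>u\<in>U. node_factor b v u) = node_sign s v"
    by (rule prod_node_factor) (use U in \<open>auto simp: b_def\<close>)
  have cc: "node_factor (\<lambda>u. complex_of_real (f u)) v u = of_real (node_factor f v u)" for f u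
    by (simp add: node_factor_def)
  have "\<bar>(\<Prod>u\<in>U. node_factor r v u) - (\<Prod>u\<in>U. node_factor b v u)\<bar> \<le> (1 + \<eta>) ^ card U - 1"
    unfolding real_norm_def[symmetric]
  proof (rule norm_prod_diff_le[OF U(1)])
    fix u assume u: "u \<in> U"
    have ru: "\<bar>r u - b u\<bar> \<le> \<eta>" using r[OF u] by (simp add: b_def)
    have "node_factor r v u - node_factor b v u = (if u = v then r u - b u
       else if strict_prefix u v then (if v ! length u then 1 else - 1) * (r u - b u) / 2 else 0)"
      by (simp add: node_factor_def field_simps)
    then show "norm (node_factor r v u - node_factor b v u) \<le> \<eta>" using ru \<eta> by (auto simp: abs_mult)
    show "norm (node_factor b v u) \<le> 1" by (auto simp: node_factor_def b_def)
  qed (use \<eta> in auto)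
  also have "\<dots> \<le> 2 ^ card U * \<eta>" using \<eta> by (rule power_one_plus_le)
  finally show ?thesis unfolding pb cc
    by (simp flip: of_real_prod of_real_diff)
qed

text \<open>One building block. \<open>bs\<close> lists coefficients with their frequencies,
  \<open>ys\<close> is the part whose sum is large at \<open>x\<close>, and \<open>B\<close>
  collects the points where a sign may be badly approximated or a discarded part is large. The
  logarithm of the length bound is proportional to the energy bound \<open>n\<close>.\<close>

lemma tree_block:
  fixes A n :: nat
  assumes A: "\<And>J. (\<Sum>k\<in>{- 2 * int J..2 * int J}. cmod (square_coeff J k) powr (3/2)) \<le> real A - 1"
    and A1: "A \<ge> 1" and n: "n \<ge> 1"
  shows "\<exists>(bs :: (complex \<times> nat) list) B.
    length bs \<le> (2 * (1024 * A) ^ 4) ^ n \<and> distinct (map snd bs) \<and> (\<forall>p\<in>set bs. 1 \<le> snd p) \<and>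
    (\<Sum>p\<leftarrow>bs. (cmod (fst p))\<^sup>2) \<le> real n \<and>
    B \<in> sets (lebesgue_on {0<..<1}) \<and> measure (lebesgue_on {0<..<1}) B \<le> 2 * (1/2) ^ n \<and>
    (\<forall>x\<in>{0<..<1} - B. \<exists>xs ys zs. bs = xs @ ys @ zs \<and>
       real n / 4 \<le> cmod (\<Sum>p\<leftarrow>ys. fst p * trig_system (snd p) x))"
proof -
  let ?M = "lebesgue_on {0<..<1::real}"
  define U where "U = set (inorder n [])"
  have U: "U = {v. length v < n}" by (auto simp: U_def set_inorder)
  have finU: "finite U" by (simp add: U_def)
  have cardU: "card U \<le> 2 ^ n"
    unfolding U_def by (simp add: distinct_card[OF distinct_inorder] length_inorder)
  have prefU: "u \<in> U" if "prefix u v" "v \<in> U" for u v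
    using that by (auto simp: U dest: prefix_length_le)
  have sprefU: "u \<in> U" if "strict_prefix u v" "v \<in> U" for u v
    using that prefU by (auto simp: strict_prefix_def)
  \<comment> \<open>Error budgets, with at most \<open>2 ^ n\<close> nodes: an error
    \<open>2 * e\<close> at each node totals at most \<open>1/4\<close>;
    \<open>2 ^ card U * \<eta> = e\<close> bounds the error of replacing signs;
    \<open>3 * \<epsilon> = (1/4) ^ n\<close> bounds the measure lost near zeros at a node;
    \<open>sqrt \<tau> * A ^ n = (1/1024) ^ n\<close> bounds the energy discarded at a node.\<close>
  define e :: real where "e = (1/2) ^ n / 8"
  define \<epsilon> :: real where "\<epsilon> = (1/4) ^ n / 3"
  define \<eta> where "\<eta> = e / 2 ^ card U"
  define \<tau> :: real where "\<tau> = (1 / (1024 * real A)) ^ (2 * n)"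
  have e0: "e > 0" by (simp add: e_def)
  have "(1/4::real) ^ n \<le> 1" by (rule power_le_one) auto
  then have \<epsilon>: "0 < \<epsilon>" "\<epsilon> \<le> 1/2" by (auto simp: \<epsilon>_def)
  have "(1/2::real) ^ n \<le> 1" by (rule power_le_one) auto
  then have "e \<le> 1" by (simp add: e_def)
  then have "e / 2 ^ card U \<le> 1 / 1" using e0 by (intro frac_le) auto
  then have \<eta>: "0 < \<eta>" "\<eta> \<le> 1" using e0 by (auto simp: \<eta>_def)
  have \<tau>0: "\<tau> > 0" using A1 by (simp add: \<tau>_def)
  define \<sigma> where "\<sigma> = sin (pi * \<epsilon>)"
  have \<sigma>0: "\<sigma> > 0" unfolding \<sigma>_def
  proof (rule sin_gt_zero)
    have "pi * \<epsilon> \<le> pi * (1/2)" using \<epsilon> by (intro mult_left_mono) auto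
    then show "pi * \<epsilon> < pi" using pi_gt_zero by linarith
  qed (use \<epsilon> in auto)
  \<comment> \<open>\<open>J\<close> may be huge compared with \<open>n\<close>: none of the bounds
    to be proved depends on it.\<close>
  obtain J :: nat where J: "4 / (\<eta> * \<sigma>) < real J" using reals_Archimedean2 by blast
  have J0: "J > 0" using J \<eta> \<sigma>0 by (metis divide_pos_pos mult_pos_pos of_nat_0_less_iff order_less_trans zero_less_numeral)
  have J\<eta>: "4 / (real J * \<sigma>) \<le> \<eta>"
    using J J0 \<eta> \<sigma>0 by (simp add: field_simps)

  \<comment> \<open>Frequencies of the digit vectors\<close>
  let ?D = "digits J U"
  have finD: "finite ?D" using finU by (intro finite_PiE) auto
  obtain m where m: "\<And>u. u \<in> U \<Longrightarrow> m u > 0" "inj_on (\<lambda>d. \<Sum>u\<in>U. d u * m u) ?D"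
    using exists_lacunary_weights[OF finU, of "2 * int J"] by auto
  define S where "S d = (\<Sum>u\<in>U. d u * m u)" for d
  define H where "H = (\<Sum>u\<in>U. 2 * int J * m u)"
  \<comment> \<open>The sums \<open>S d\<close> may be negative; adding \<open>H + 1\<close> makes
    all frequencies at least \<open>1\<close> and multiplies every function by the same unimodular
    \<open>trig_system l0 x\<close>.\<close>
  define fr where "fr d = nat (S d + H + 1)" for d
  define l0 where "l0 = nat (H + 1)"
  have H0: "H \<ge> 0" unfolding H_def using m(1) by (intro sum_nonneg) (simp add: less_imp_le)
  have SH: "\<bar>S d\<bar> \<le> H" if "d \<in> ?D" for d
    unfolding S_def H_def
  proof (rule order_trans[OF sum_abs], rule sum_mono)
    fix u assume u: "u \<in> U"
    then have "d u \<in> {- 2 * int J..2 * int J}" using that by auto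
    then have "\<bar>d u\<bar> * m u \<le> 2 * int J * m u" using m(1)[OF u] by (intro mult_right_mono) auto
    then show "\<bar>d u * m u\<bar> \<le> 2 * int J * m u" using m(1)[OF u] by (simp add: abs_mult)
  qed
  have fr1: "fr d \<ge> 1" if "d \<in> ?D" for d using SH[OF that] by (simp add: fr_def)
  have frinj: "inj_on fr ?D"
  proof (rule inj_onI)
    fix d d' assume dd: "d \<in> ?D" "d' \<in> ?D" "fr d = fr d'"
    then have "S d = S d'" using SH[of d] SH[of d'] by (simp add: fr_def)
    then show "d = d'" using dd m(2) by (auto simp: S_def dest: inj_onD)
  qed
  have frtrig: "trig_system (fr d) x = cis (\<Sum>u\<in>U. of_int (d u) * (2 * pi * of_int (m u) * x)) * trig_system l0 x"
    if "d \<in> ?D" for d x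
  proof -
    have "real (fr d) = of_int (S d) + real l0"
      using SH[OF that] H0 by (simp add: fr_def l0_def)
    moreover have "(\<Sum>u\<in>U. of_int (d u) * (2 * pi * of_int (m u) * x)) = 2 * pi * of_int (S d) * x"
      by (simp add: S_def sum_distrib_left sum_distrib_right mult_ac)
    ultimately show ?thesis by (simp add: trig_system_cis cis_mult algebra_simps)
  qed

  \<comment> \<open>Truncation to the large coefficients\<close>
  define c where "c = tree_coeff J U"
  define K where "K v = {d\<in>?D. \<tau> \<le> cmod (c v d)}" for v
  define R where "R v = {d\<in>?D. cmod (c v d) < \<tau>}" for v
  have KR: "?D = K v \<union> R v" "K v \<inter> R v = {}" for v by (auto simp: K_def R_def)
  have finK: "finite (K v)" and finR: "finite (R v)" for v using finD by (auto simp: K_def R_def)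
  define P where "P v x = (\<Prod>u\<in>U. node_factor (\<lambda>u. complex_of_real (square_wave J (2 * pi * of_int (m u) * x))) v u)" for v x
  define Q where "Q v x = (\<Sum>d\<in>K v. c v d * trig_system (fr d) x)" for v x
  define T where "T v x = (\<Sum>d\<in>R v. c v d * trig_system (fr d) x)" for v x
  have PQT: "Q v x = P v x * trig_system l0 x - T v x" for v x
  proof -
    have "P v x * trig_system l0 x = (\<Sum>d\<in>?D. c v d * trig_system (fr d) x)"
      unfolding P_def c_def tree_coeff_fourier[OF finU, symmetric] sum_distrib_right
      by (rule sum.cong) (auto simp: frtrig)
    also have "\<dots> = Q v x + T v x"
      unfolding Q_def T_def by (subst (1) KR(1)[of v]) (rule sum.union_disjoint[OF finK finR KR(2)])
    finally show ?thesis by simp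
  qed
  have energy: "(\<Sum>d\<in>?D. (cmod (c v d))\<^sup>2) \<le> (1/2) ^ length v" if "v \<in> U" for v
    unfolding c_def using sprefU that by (intro tree_coeff_energy finU) auto
  have energyK: "(\<Sum>d\<in>K v. (cmod (c v d))\<^sup>2) \<le> (1/2) ^ length v" if "v \<in> U" for v
    using energy[OF that] finD by (intro order_trans[OF sum_mono2 energy[OF that]]) (auto simp: K_def)
  have energyR: "(\<Sum>d\<in>R v. (cmod (c v d))\<^sup>2) \<le> (1/1024) ^ n" if "v \<in> U" for v
  proof -
    have len: "Suc (length v) \<le> n" using that by (simp add: U)
    have "(\<Sum>d\<in>?D. cmod (c v d) powr (3/2)) \<le> (1 + (real A - 1)) ^ Suc (length v)"
      unfolding c_def using A1 prefU that by (intro tree_coeff_three_halves A finU) auto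
    also have "\<dots> \<le> real A ^ n" using A1 power_increasing[OF len, of "real A"] by simp
    finally have "(\<Sum>d\<in>R v. (cmod (c v d))\<^sup>2) \<le> sqrt \<tau> * real A ^ n"
      unfolding R_def using \<tau>0 by (intro order_trans[OF small_coeffs_energy[OF finD \<tau>0]] mult_left_mono) auto
    also have "sqrt \<tau> = (1 / (1024 * real A)) ^ n"
      unfolding \<tau>_def power_mult real_sqrt_power using A1 by (simp add: power2_eq_square)
    also have "(1 / (1024 * real A)) ^ n * real A ^ n = (1/1024) ^ n"
      using A1 by (simp flip: power_mult_distrib)
    finally show ?thesis .
  qed

  \<comment> \<open>The exceptional set\<close>
  define Bt where "Bt v = {x\<in>{0<..<1}. cmod (T v x) \<ge> e}" for v
  have Rs: "finite (R v)" "inj_on fr (R v)" "\<And>d. d \<in> R v \<Longrightarrow> fr d \<ge> 1" for v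
    using finR frinj fr1 by (auto simp: R_def intro: inj_on_subset)
  have Bt: "Bt v \<in> sets ?M" "measure ?M (Bt v) \<le> (1/4) ^ n" if "v \<in> U" for v
  proof -
    show "Bt v \<in> sets ?M" unfolding Bt_def T_def by (rule trig_chebyshev(1)[OF Rs e0])
    have "measure ?M (Bt v) \<le> (\<Sum>d\<in>R v. (cmod (c v d))\<^sup>2) / e\<^sup>2"
      unfolding Bt_def T_def by (rule trig_chebyshev(2)[OF Rs e0])
    \<comment> \<open>The constant \<open>1024\<close> outweighs the factor from Chebyshev's
      inequality: \<open>e\<^sup>2 = (1/4) ^ n / 64\<close> leaves \<open>64 * (1/256) ^ n\<close>,
      and \<open>64 \<le> 64 ^ n\<close> as \<open>n\<close> is positive.\<close>
    also have "\<dots> \<le> (1/1024) ^ n / e\<^sup>2" using energyR[OF that] by (intro divide_right_mono) auto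
    also have "\<dots> = 64 * (1/256) ^ n"
    proof -
      have e2: "e\<^sup>2 = (1/4) ^ n / 64"
        by (simp add: e_def power_divide power2_eq_square flip: power_mult_distrib)
      have split: "(1/1024::real) ^ n = (1/256) ^ n * (1/4) ^ n" by (simp flip: power_mult_distrib)
      show ?thesis unfolding e2 split by simp
    qed
    also have "\<dots> \<le> 64 ^ n * (1/256) ^ n"
      using n power_increasing[of 1 n "64::real"] by (intro mult_right_mono) auto
    also have "\<dots> = (1/4::real) ^ n" by (simp flip: power_mult_distrib)
    finally show "measure ?M (Bt v) \<le> (1/4) ^ n" .
  qed
  define B where "B = (\<Union>u\<in>U. near_zeros (m u) \<epsilon> \<union> Bt u)"
  have nz: "near_zeros (m u) \<epsilon> \<in> sets ?M" "measure ?M (near_zeros (m u) \<epsilon>) \<le> (1/4) ^ n" if "u \<in> U" for u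
    using near_zeros_measure[OF m(1)[OF that] \<epsilon>] by (auto simp: \<epsilon>_def)
  have Bsets: "B \<in> sets ?M" unfolding B_def using nz Bt finU by (intro sets.finite_UN) auto
  have Bmeas: "measure ?M B \<le> 2 * (1/2) ^ n"
  proof -
    interpret finite_measure ?M by (rule finite_measure_lebesgue_on) auto
    have "measure ?M B \<le> (\<Sum>u\<in>U. measure ?M (near_zeros (m u) \<epsilon> \<union> Bt u))"
      unfolding B_def using nz Bt finU by (intro measure_UNION_le) auto
    also have "\<dots> \<le> (\<Sum>u\<in>U. (1/4) ^ n + (1/4) ^ n)"
      using nz Bt by (intro sum_mono order_trans[OF measure_Un_le] add_mono) auto
    also have "\<dots> = real (card U) * (2 * (1/4) ^ n)" by simp
    also have "\<dots> \<le> 2 ^ n * (2 * (1/4) ^ n)"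
      using cardU by (intro mult_right_mono) (auto simp flip: of_nat_le_iff)
    also have "\<dots> = 2 * (1/2::real) ^ n" by (simp flip: power_mult_distrib)
    finally show ?thesis .
  qed

  \<comment> \<open>The list of retained terms\<close>
  have "\<exists>l. \<forall>v. distinct (l v) \<and> set (l v) = K v"
    using finite_distinct_list[OF finK] by metis
  then obtain l where l: "\<And>v. distinct (l v)" "\<And>v. set (l v) = K v" by blast
  \<comment> \<open>Any order within a node will do, because the blocks to be used consist of the
    full lists of consecutive nodes.\<close>
  define L where "L v = map (\<lambda>d. (c v d, fr d)) (l v)" for v
  define bs where "bs = concat (map L (inorder n []))"
  have sumL: "(\<Sum>p\<leftarrow>L v. g (fst p) (snd p)) = (\<Sum>d\<in>K v. g (c v d) (fr d))" for v and g :: "complex \<Rightarrow> nat \<Rightarrow> 'z::comm_monoid_add"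
    unfolding L_def l(2)[symmetric] sum_list_distinct_conv_sum_set[OF l(1), symmetric] by (simp add: o_def)
  have len: "length bs \<le> (2 * (1024 * A) ^ 4) ^ n"
  proof -
    have "length (L v) = card (K v)" for v
      by (simp add: L_def distinct_card[OF l(1)] flip: l(2))
    then have "real (length bs) = (\<Sum>v\<leftarrow>inorder n []. real (card (K v)))"
      unfolding bs_def by (subst length_concat_map) simp
    also have "\<dots> = (\<Sum>v\<in>U. real (card (K v)))"
      unfolding U_def by (rule sum_list_distinct_conv_sum_set[OF distinct_inorder])
    also have "\<dots> \<le> (\<Sum>v\<in>U. 1 / \<tau>\<^sup>2)"
    proof (rule sum_mono)
      fix v assume "v \<in> U"
      have "(1/2::real) ^ length v \<le> 1" by (rule power_le_one) auto
      then show "real (card (K v)) \<le> 1 / \<tau>\<^sup>2"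
        unfolding K_def using energy[OF \<open>v \<in> U\<close>] by (intro card_large_coeffs finD \<tau>0) linarith
    qed
    also have "\<dots> \<le> 2 ^ n * (1 / \<tau>\<^sup>2)"
      using cardU by (auto intro!: divide_right_mono simp flip: of_nat_le_iff)
    also have "1 / \<tau>\<^sup>2 = ((1024 * real A) ^ 4) ^ n"
    proof -
      have "((1 / a) ^ (2 * n))\<^sup>2 = 1 / (a ^ 4) ^ n" for a :: real
        by (simp add: power_one_over mult_ac flip: power_mult)
      then show ?thesis by (simp only: \<tau>_def) simp
    qed
    also have "2 ^ n * ((1024 * real A) ^ 4) ^ n = real ((2 * (1024 * A) ^ 4) ^ n)"
      by (simp only: of_nat_power of_nat_mult of_nat_numeral power_mult_distrib)
    finally show ?thesis by linarith
  qed
  have dist: "distinct (map snd bs)"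
  proof -
    have "map snd bs = concat (map (\<lambda>v. map fr (l v)) (inorder n []))"
      by (simp add: bs_def L_def map_concat o_def)
    moreover have "distinct (concat (map (\<lambda>v. map fr (l v)) (inorder n [])))"
    proof (rule distinct_concat_map[OF distinct_inorder])
      fix v assume "v \<in> set (inorder n [])"
      show "distinct (map fr (l v))"
        using l frinj by (auto simp: distinct_map K_def intro: inj_on_subset)
    next
      fix v w assume vw: "v \<in> set (inorder n [])" "w \<in> set (inorder n [])" "v \<noteq> w"
      show "set (map fr (l v)) \<inter> set (map fr (l w)) = {}"
      proof (rule ccontr)
        assume "\<not> ?thesis"
        then obtain d d' where dd: "d \<in> K v" "d' \<in> K w" "fr d = fr d'" by (auto simp: l(2))
        then have "d = d'" using frinj by (auto simp: K_def dest: inj_onD)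
        then have "c v d \<noteq> 0" "c w d \<noteq> 0" using dd \<tau>0 by (auto simp: K_def)
        then have "v = w" using vw unfolding c_def by (intro tree_coeff_disjoint[OF finU]) (auto simp: U_def)
        then show False using vw by simp
      qed
    qed
    ultimately show ?thesis by simp
  qed
  have pos: "\<forall>p\<in>set bs. 1 \<le> snd p"
    using fr1 by (auto simp: bs_def L_def l(2) K_def)
  have en: "(\<Sum>p\<leftarrow>bs. (cmod (fst p))\<^sup>2) \<le> real n"
  proof -
    have "(\<Sum>p\<leftarrow>bs. (cmod (fst p))\<^sup>2) = (\<Sum>v\<leftarrow>inorder n []. \<Sum>d\<in>K v. (cmod (c v d))\<^sup>2)"
      unfolding bs_def sum_list_concat_map sumL[of "\<lambda>a b. (cmod a)\<^sup>2"] ..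
    also have "\<dots> \<le> (\<Sum>v\<leftarrow>inorder n []. (1/2) ^ length v)"
      by (intro sum_list_mono energyK) (simp add: U_def)
    finally show ?thesis by (simp add: sum_list_inorder_power)
  qed

  \<comment> \<open>Large block sums outside the exceptional set\<close>
  have good: "\<exists>xs ys zs. bs = xs @ ys @ zs \<and> real n / 4 \<le> cmod (\<Sum>p\<leftarrow>ys. fst p * trig_system (snd p) x)"
    if x: "x \<in> {0<..<1} - B" for x
  proof -
    \<comment> \<open>Outside \<open>B\<close> none of the sines at the nodes in \<open>U\<close>
      vanishes, so there \<open>\<not> s u\<close> means a negative sign.\<close>
    define s where "s u \<longleftrightarrow> sin (2 * pi * of_int (m u) * x) > 0" for u
    have sw: "\<bar>square_wave J (2 * pi * of_int (m u) * x) - (if s u then 1 else - 1)\<bar> \<le> \<eta>" if "u \<in> U" for u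
    proof -
      have "x \<in> {0<..<1} - near_zeros (m u) \<epsilon>" using x that by (auto simp: B_def)
      then have ge: "\<bar>sin (2 * pi * of_int (m u) * x)\<bar> \<ge> \<sigma>"
        unfolding \<sigma>_def by (rule sin_ge_outside_near_zeros[OF _ \<epsilon>])
      then have nz: "sin (2 * pi * of_int (m u) * x) \<noteq> 0" using \<sigma>0 by auto
      have "4 / (real J * \<bar>sin (2 * pi * of_int (m u) * x)\<bar>) \<le> 4 / (real J * \<sigma>)"
        using ge J0 \<sigma>0 by (intro divide_left_mono mult_left_mono) auto
      moreover have "sgn (sin (2 * pi * of_int (m u) * x)) = (if s u then 1 else - 1)"
        using nz by (simp add: s_def sgn_if)
      ultimately show ?thesis using square_wave_approx[OF J0 nz] J\<eta> by linarith
    qed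
    have app: "cmod (Q v x - trig_system l0 x * of_real (node_sign s v)) \<le> 2 * e" if "v \<in> U" for v
    proof -
      have "cmod (P v x - of_real (node_sign s v)) \<le> 2 ^ card U * \<eta>"
        unfolding P_def by (rule tree_product_approx) (use finU that sprefU sw \<eta> in auto)
      then have 1: "cmod (P v x - of_real (node_sign s v)) \<le> e" by (simp add: \<eta>_def)
      have 2: "cmod (T v x) \<le> e" using x that by (force simp: B_def Bt_def)
      have "Q v x - trig_system l0 x * of_real (node_sign s v)
          = trig_system l0 x * (P v x - of_real (node_sign s v)) - T v x"
        by (simp add: PQT algebra_simps)
      also have "cmod \<dots> \<le> cmod (trig_system l0 x * (P v x - of_real (node_sign s v))) + cmod (T v x)"
        by (rule norm_triangle_ineq4)
      also have "\<dots> \<le> 2 * e" using 1 2 by (simp add: norm_mult)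
      finally show ?thesis .
    qed
    obtain X Y where XY: "inorder n [] = X @ Y"
        "sum_list (map (node_sign s) Y) - sum_list (map (node_sign s) X) = real n"
      using inorder_split[of s "[]" n] by auto
    \<comment> \<open>The approximation errors cost at most \<open>1/4\<close>, and
      \<open>n / 2 - 1 / 4\<close> is at least \<open>n / 4\<close> because \<open>n\<close> is
      positive.\<close>
    have block: "real n / 4 \<le> cmod (\<Sum>p\<leftarrow>concat (map L Z). fst p * trig_system (snd p) x)"
      if Z: "set Z \<subseteq> U" "length Z \<le> 2 ^ n" "\<bar>sum_list (map (node_sign s) Z)\<bar> \<ge> real n / 2" for Z
    proof -
      have "(\<Sum>p\<leftarrow>concat (map L Z). fst p * trig_system (snd p) x) = (\<Sum>v\<leftarrow>Z. Q v x)"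
        unfolding sum_list_concat_map sumL[of "\<lambda>a b. a * trig_system b x"] Q_def ..
      moreover have "(\<Sum>v\<leftarrow>Z. trig_system l0 x * of_real (node_sign s v)) = trig_system l0 x * of_real (\<Sum>v\<leftarrow>Z. node_sign s v)"
        by (induction Z) (auto simp: algebra_simps)
      moreover have "cmod ((\<Sum>v\<leftarrow>Z. Q v x) - (\<Sum>v\<leftarrow>Z. trig_system l0 x * of_real (node_sign s v))) \<le> real (length Z) * (2 * e)"
        using Z app by (intro norm_sum_list_diff_le) auto
      moreover have "real (length Z) * (2 * e) \<le> 1/4"
      proof -
        have "real (length Z) * (2 * e) \<le> 2 ^ n * (2 * e)"
          using Z(2) e0 by (intro mult_right_mono) (auto simp flip: of_nat_le_iff)
        also have "\<dots> = 1/4" by (simp add: e_def flip: power_mult_distrib)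
        finally show ?thesis .
      qed
      moreover have "cmod (trig_system l0 x * of_real (\<Sum>v\<leftarrow>Z. node_sign s v)) \<ge> real n / 2"
        using Z(3) by (simp add: norm_mult)
      ultimately have "real n / 2 - 1/4 \<le> cmod (\<Sum>p\<leftarrow>concat (map L Z). fst p * trig_system (snd p) x)"
        using norm_triangle_ineq2[of "trig_system l0 x * of_real (\<Sum>v\<leftarrow>Z. node_sign s v)" "\<Sum>v\<leftarrow>Z. Q v x"]
        by (simp add: norm_minus_commute)
      moreover have "real n / 4 \<le> real n / 2 - 1/4" using n by simp
      ultimately show ?thesis by linarith
    qed
    have sub: "set X \<subseteq> U" "set Y \<subseteq> U" using XY(1) by (auto simp: U_def)
    have "length (X @ Y) \<le> 2 ^ n" unfolding XY(1)[symmetric] by (simp add: length_inorder)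
    then have lenXY: "length X \<le> 2 ^ n" "length Y \<le> 2 ^ n" by auto
    have bsXY: "bs = concat (map L X) @ concat (map L Y)" by (simp add: bs_def XY(1))
    \<comment> \<open>The two sums differ by \<open>n\<close>, so one of them has modulus at least
      \<open>n / 2\<close>.\<close>
    consider "\<bar>sum_list (map (node_sign s) X)\<bar> \<ge> real n / 2" | "\<bar>sum_list (map (node_sign s) Y)\<bar> \<ge> real n / 2"
      using XY(2) by linarith
    then show ?thesis
    proof cases
      case 1
      then show ?thesis using bsXY block[OF sub(1) lenXY(1)]
        by (intro exI[of _ "[]"] exI[of _ "concat (map L X)"] exI[of _ "concat (map L Y)"]) simp
    next
      case 2
      then show ?thesis using bsXY block[OF sub(2) lenXY(2)]
        by (intro exI[of _ "concat (map L X)"] exI[of _ "concat (map L Y)"] exI[of _ "[]"]) simp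
    qed
  qed
  show ?thesis using len dist pos en Bsets Bmeas good by blast
qed

subsection \<open>Concatenation of blocks\<close>

text \<open>Both complements are countably infinite, so some bijection between them completes
  \<open>\<tau>\<close>.\<close>

lemma extend_to_permutation:
  fixes \<tau> :: "nat \<Rightarrow> nat"
  assumes "A \<subseteq> X" "inj_on \<tau> A" "\<tau> ` A \<subseteq> X" "infinite (X - A)" "infinite (X - \<tau> ` A)"
  obtains \<sigma> where "bij_betw \<sigma> X X" "\<And>p. p \<in> A \<Longrightarrow> \<sigma> p = \<tau> p"
proof -
  define g where "g = from_nat_into (X - \<tau> ` A) \<circ> to_nat_on (X - A)"
  have g: "bij_betw g (X - A) (X - \<tau> ` A)"
    unfolding g_def using assms
    by (intro bij_betw_trans[OF to_nat_on_infinite bij_betw_from_nat_into]) auto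
  define \<sigma> where "\<sigma> p = (if p \<in> A then \<tau> p else g p)" for p
  have "bij_betw \<sigma> A (\<tau> ` A)"
    using assms(2) by (auto simp: bij_betw_def \<sigma>_def inj_on_def)
  moreover have "bij_betw \<sigma> (X - A) (X - \<tau> ` A)"
    using g by (rule bij_betw_cong[THEN iffD1, rotated]) (simp add: \<sigma>_def)
  ultimately have "bij_betw \<sigma> (A \<union> (X - A)) (\<tau> ` A \<union> (X - \<tau> ` A))"
    by (rule bij_betw_combine) auto
  moreover have "A \<union> (X - A) = X" "\<tau> ` A \<union> (X - \<tau> ` A) = X" using assms by auto
  ultimately show ?thesis using that[of \<sigma>] by (simp add: \<sigma>_def)
qed

text \<open>Block \<open>k\<close> occupies the positions from \<open>st k\<close> on, with its
  frequencies shifted by an offset that keeps the ranges of different blocks apart. The shift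
  multiplies a block sum by a unimodular factor, hence the equality of moduli. Infinitely many
  positions and frequencies stay free for the remainder of the permutation.\<close>

lemma arrange_blocks:
  fixes bs :: "nat \<Rightarrow> (complex \<times> nat) list" and st :: "nat \<Rightarrow> nat" and w :: "nat \<Rightarrow> real"
  assumes st0: "st 0 \<ge> 1" and gap: "\<And>k. st k + length (bs k) < st (Suc k)"
    and dist: "\<And>k. distinct (map snd (bs k))" and pos: "\<And>k p. p \<in> set (bs k) \<Longrightarrow> snd p \<ge> 1"
    and wpos: "\<And>n. n \<ge> 1 \<Longrightarrow> w n > 0" and wmono: "mono_on {1..} w"
    and sm: "summable (\<lambda>k. (\<Sum>p\<leftarrow>bs k. (cmod (fst p))\<^sup>2) * w (st k + length (bs k)))"
  shows "\<exists>(a :: nat \<Rightarrow> complex) \<sigma>.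
    summable (\<lambda>n. (cmod (a (Suc n)))\<^sup>2 * w (Suc n)) \<and> bij_betw \<sigma> {1..} {1..} \<and>
    (\<forall>k xs ys zs x. bs k = xs @ ys @ zs \<longrightarrow>
      cmod (\<Sum>n = st k + length xs..<st k + length xs + length ys. a n * trig_system (\<sigma> n) x)
      = cmod (\<Sum>p\<leftarrow>ys. fst p * trig_system (snd p) x))"
proof -
  define I where "I k = {st k..<st k + length (bs k)}" for k
  \<comment> \<open>The sum of the frequencies is a convenient bound for each of them. The
    \<open>+ 1\<close> in \<open>off\<close> leaves the frequency \<open>off (Suc k)\<close> free,
    just as the strict inequality in \<open>gap\<close> leaves a position free after each
    block.\<close>
  define H where "H k = sum_list (map snd (bs k))" for k
  define off where "off k = (\<Sum>i<k. H i + 1)" for k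
  have st_mono: "strict_mono st" using gap by (intro strict_mono_Suc_iff[THEN iffD2]) (meson le_add1 le_less_trans)
  have off_mono: "strict_mono off" by (intro strict_mono_Suc_iff[THEN iffD2]) (simp add: off_def)
  have st_gt: "k < st k" for k
  proof (induction k)
    case (Suc k)
    then show ?case using strict_monoD[OF st_mono, of k "Suc k"] by simp
  qed (use st0 in simp)
  have st_sep: "st k + length (bs k) < st k'" if "k < k'" for k k'
    using gap[of k] strict_mono_less_eq[OF st_mono, of "Suc k" k'] that by simp
  have I_disj: "k = k'" if "p \<in> I k" "p \<in> I k'" for p k k'
    using st_sep[of k k'] st_sep[of k' k] that by (cases k k' rule: linorder_cases) (auto simp: I_def)
  define A where "A = (\<Union>k. I k)"
  define kof where "kof p = (THE k. p \<in> I k)" for p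
  have kof: "kof p = k" if "p \<in> I k" for p k
    unfolding kof_def using that I_disj by blast
  have kofA: "p \<in> I (kof p)" if "p \<in> A" for p using that kof by (auto simp: A_def)
  define entry where "entry p = bs (kof p) ! (p - st (kof p))" for p
  have entry: "entry (st k + i) = bs k ! i" if "i < length (bs k)" for k i
    using kof[of "st k + i" k] that by (simp add: entry_def I_def)
  have entry_in: "entry p \<in> set (bs (kof p))" if "p \<in> A" for p
    using kofA[OF that] by (auto simp: entry_def I_def)
  \<comment> \<open>The coefficient is \<open>0\<close> off the blocks, so the part of the
    permutation that only fills up contributes nothing.\<close>
  define a where "a p = (if p \<in> A then fst (entry p) else 0)" for p
  define \<tau> where "\<tau> p = off (kof p) + snd (entry p)" for p
  have \<tau>_range: "off (kof p) < \<tau> p" "\<tau> p < off (Suc (kof p))" if "p \<in> A" for p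
  proof -
    show "off (kof p) < \<tau> p" using pos[OF entry_in[OF that]] by (simp add: \<tau>_def)
    have "snd (entry p) \<le> H (kof p)"
      unfolding H_def using entry_in[OF that] by (intro member_le_sum_list) auto
    then show "\<tau> p < off (Suc (kof p))" by (simp add: \<tau>_def off_def)
  qed
  have off_sep: "\<tau> p < \<tau> q" if "p \<in> A" "q \<in> A" "kof p < kof q" for p q
    using \<tau>_range(2)[OF that(1)] \<tau>_range(1)[OF that(2)] strict_mono_less_eq[OF off_mono, of "Suc (kof p)" "kof q"] that(3)
    by simp
  have "inj_on \<tau> A"
  proof (rule inj_onI)
    fix p q assume pq: "p \<in> A" "q \<in> A" "\<tau> p = \<tau> q"
    then have k: "kof p = kof q" using off_sep[of p q] off_sep[of q p] by (metis linorder_neqE_nat nat_less_le)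
    define k where "k = kof p"
    have pI: "p \<in> I k" "q \<in> I k" using kofA[OF pq(1)] kofA[OF pq(2)] k by (simp_all add: k_def)
    have "snd (entry p) = snd (entry q)" using pq(3) k by (simp add: \<tau>_def)
    then have "map snd (bs k) ! (p - st k) = map snd (bs k) ! (q - st k)"
      using pI k by (auto simp: entry_def k_def I_def)
    then have "p - st k = q - st k"
      using dist[of k] pI by (subst (asm) nth_eq_iff_index_eq) (auto simp: I_def)
    then show "p = q" using pI by (auto simp: I_def)
  qed
  moreover have "A \<subseteq> {1..}"
  proof
    fix p assume "p \<in> A"
    then obtain k where "p \<in> I k" by (auto simp: A_def)
    then show "p \<in> {1..}" using st_gt[of k] by (auto simp: I_def)
  qed
  moreover have "\<tau> ` A \<subseteq> {1..}" using \<tau>_range by (auto simp: Suc_le_eq dest!: \<tau>_range(1))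
  moreover have "infinite ({1..} - A)"
  proof
    assume fin: "finite ({1..} - A)"
    have "range (\<lambda>k. st k + length (bs k)) \<subseteq> {1..} - A"
    proof (intro image_subsetI DiffI notI)
      fix k
      show "st k + length (bs k) \<in> {1..}" using st_gt[of k] by simp
      assume "st k + length (bs k) \<in> A"
      then obtain k' where "st k + length (bs k) \<in> I k'" by (auto simp: A_def)
      then show False using st_sep[of k k'] st_sep[of k' k]
        by (cases k k' rule: linorder_cases) (auto simp: I_def)
    qed
    moreover have "inj (\<lambda>k. st k + length (bs k))"
      by (intro strict_mono_imp_inj_on strict_monoI order_less_le_trans[OF st_sep]) auto
    ultimately show False using fin by (meson finite_subset range_inj_infinite)
  qed
  moreover have "infinite ({1..} - \<tau> ` A)"
  proof
    assume fin: "finite ({1..} - \<tau> ` A)"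
    have "range (\<lambda>k. off (Suc k)) \<subseteq> {1..} - \<tau> ` A"
    proof (intro image_subsetI DiffI notI)
      fix k
      show "off (Suc k) \<in> {1..}" by (simp add: off_def)
      assume "off (Suc k) \<in> \<tau> ` A"
      then obtain p where "p \<in> A" "off (Suc k) = \<tau> p" by auto
      then have "off (kof p) < off (Suc k)" "off (Suc k) < off (Suc (kof p))" using \<tau>_range[of p] by auto
      then show False using strict_mono_less[OF off_mono] by auto
    qed
    moreover have "inj (\<lambda>k. off (Suc k))"
      using strict_mono_imp_inj_on[OF off_mono] by (auto simp: inj_on_def)
    ultimately show False using fin by (meson finite_subset range_inj_infinite)
  qed
  ultimately obtain \<sigma> where \<sigma>: "bij_betw \<sigma> {1..} {1..}" "\<And>p. p \<in> A \<Longrightarrow> \<sigma> p = \<tau> p"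
    by (metis extend_to_permutation)
  have inA: "st k + i \<in> A" if "i < length (bs k)" for k i unfolding A_def I_def
    by (rule UN_I[of k]) (use that in auto)
  have energy: "(\<Sum>p\<in>I k. (cmod (a p))\<^sup>2 * w p) \<le> (\<Sum>p\<leftarrow>bs k. (cmod (fst p))\<^sup>2) * w (st k + length (bs k))" for k
  proof -
    have "(\<Sum>p\<in>I k. (cmod (a p))\<^sup>2 * w p) \<le> (\<Sum>p\<in>I k. (cmod (a p))\<^sup>2 * w (st k + length (bs k)))"
    proof (intro sum_mono mult_left_mono)
      fix p assume "p \<in> I k"
      then show "w p \<le> w (st k + length (bs k))"
        using st_gt[of k] by (intro mono_onD[OF wmono]) (auto simp: I_def)
    qed auto
    also have "\<dots> = (\<Sum>p\<in>I k. (cmod (a p))\<^sup>2) * w (st k + length (bs k))"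
      by (simp add: sum_distrib_right)
    also have "(\<Sum>p\<in>I k. (cmod (a p))\<^sup>2) = (\<Sum>i<length (bs k). (cmod (a (st k + i)))\<^sup>2)"
      unfolding I_def by (rule sum.reindex_bij_witness[of _ "\<lambda>i. st k + i" "\<lambda>p. p - st k"]) auto
    also have "\<dots> = (\<Sum>i<length (bs k). (cmod (fst (bs k ! i)))\<^sup>2)"
      by (rule sum.cong) (auto simp: a_def inA entry)
    also have "\<dots> = (\<Sum>p\<leftarrow>bs k. (cmod (fst p))\<^sup>2)"
      by (simp add: sum_list_sum_nth atLeast0LessThan)
    finally show ?thesis .
  qed
  let ?F = "\<lambda>k. (\<Sum>p\<leftarrow>bs k. (cmod (fst p))\<^sup>2) * w (st k + length (bs k))"
  have F0: "?F k \<ge> 0" for k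
    using wpos[of "st k + length (bs k)"] st_gt[of k] by (intro mult_nonneg_nonneg sum_list_nonneg) auto
  have "summable (\<lambda>n. (cmod (a (Suc n)))\<^sup>2 * w (Suc n))"
  proof (rule summableI_nonneg_bounded[where x = "suminf ?F"])
    show "0 \<le> (cmod (a (Suc n)))\<^sup>2 * w (Suc n)" for n using wpos[of "Suc n"] by simp
    fix N
    have "(\<Sum>n<N. (cmod (a (Suc n)))\<^sup>2 * w (Suc n)) = (\<Sum>p\<in>{1..N}. (cmod (a p))\<^sup>2 * w p)"
      by (rule sum.reindex_bij_witness[of _ "\<lambda>p. p - 1" Suc]) auto
    also have "\<dots> = (\<Sum>p\<in>{1..N} \<inter> A. (cmod (a p))\<^sup>2 * w p)"
      by (rule sum.mono_neutral_right) (auto simp: a_def)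
    also have "\<dots> \<le> (\<Sum>p\<in>(\<Union>k<N. I k). (cmod (a p))\<^sup>2 * w p)"
    proof (rule sum_mono2)
      show "finite (\<Union>k<N. I k)" by (auto simp: I_def)
      show "{1..N} \<inter> A \<subseteq> (\<Union>k<N. I k)"
      proof
        fix p assume p: "p \<in> {1..N} \<inter> A"
        then obtain k where k: "p \<in> I k" by (auto simp: A_def)
        then have "k < N" using st_gt[of k] p by (auto simp: I_def)
        then show "p \<in> (\<Union>k<N. I k)" using k by auto
      qed
      fix p assume "p \<in> (\<Union>k<N. I k) - {1..N} \<inter> A"
      then have "p \<ge> 1" using \<open>A \<subseteq> {1..}\<close> by (auto simp: A_def)
      then show "0 \<le> (cmod (a p))\<^sup>2 * w p" using wpos[of p] by simp
    qed
    also have "\<dots> = (\<Sum>k<N. \<Sum>p\<in>I k. (cmod (a p))\<^sup>2 * w p)"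
    proof (rule sum.UNION_disjoint)
      show "\<forall>k\<in>{..<N}. \<forall>k'\<in>{..<N}. k \<noteq> k' \<longrightarrow> I k \<inter> I k' = {}" using I_disj by blast
    qed (auto simp: I_def)
    also have "\<dots> \<le> (\<Sum>k<N. ?F k)" by (intro sum_mono energy)
    also have "\<dots> \<le> suminf ?F" using F0 by (intro sum_le_suminf[OF sm]) auto
    finally show "(\<Sum>n<N. (cmod (a (Suc n)))\<^sup>2 * w (Suc n)) \<le> suminf ?F" .
  qed
  moreover have "cmod (\<Sum>n = st k + length xs..<st k + length xs + length ys. a n * trig_system (\<sigma> n) x)
      = cmod (\<Sum>p\<leftarrow>ys. fst p * trig_system (snd p) x)" if bs: "bs k = xs @ ys @ zs" for k xs ys zs x
  proof -
    have "(\<Sum>n = st k + length xs..<st k + length xs + length ys. a n * trig_system (\<sigma> n) x)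
        = (\<Sum>j<length ys. a (st k + (length xs + j)) * trig_system (\<sigma> (st k + (length xs + j))) x)"
      by (rule sum.reindex_bij_witness[of _ "\<lambda>j. st k + (length xs + j)" "\<lambda>p. p - (st k + length xs)"]) auto
    also have "\<dots> = (\<Sum>j<length ys. trig_system (off k) x * (fst (ys ! j) * trig_system (snd (ys ! j)) x))"
    proof (rule sum.cong[OF refl])
      fix j assume "j \<in> {..<length ys}"
      then have j: "length xs + j < length (bs k)" "bs k ! (length xs + j) = ys ! j"
        by (auto simp: bs nth_append)
      have "kof (st k + (length xs + j)) = k" by (rule kof) (use j in \<open>auto simp: I_def\<close>)
      then show "a (st k + (length xs + j)) * trig_system (\<sigma> (st k + (length xs + j))) x
          = trig_system (off k) x * (fst (ys ! j) * trig_system (snd (ys ! j)) x)"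
        using inA[OF j(1)] entry[OF j(1)] j(2) by (simp add: a_def \<sigma>(2) \<tau>_def trig_system_add)
    qed
    also have "\<dots> = trig_system (off k) x * (\<Sum>p\<leftarrow>ys. fst p * trig_system (snd p) x)"
      by (simp add: sum_list_sum_nth atLeast0LessThan sum_distrib_left)
    finally show ?thesis by (simp add: norm_mult)
  qed
  ultimately show ?thesis using \<sigma>(1) by blast
qed

lemma not_summable_if_large_blocks:
  fixes f :: "nat \<Rightarrow> complex"
  assumes "\<And>N. \<exists>i j. N < i \<and> 1 \<le> cmod (\<Sum>n = i..<j. f n)"
  shows "\<not> summable (\<lambda>n. f (Suc n))"
proof
  assume "summable (\<lambda>n. f (Suc n))"
  then have "summable f" by (simp add: summable_Suc_iff)
  then obtain N where "\<And>m n. m \<ge> N \<Longrightarrow> cmod (\<Sum>k = m..<n. f k) < 1"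
    unfolding summable_Cauchy by (metis zero_less_one)
  moreover obtain i j where "N < i" "1 \<le> cmod (\<Sum>n = i..<j. f n)" using assms by blast
  ultimately show False by (metis less_imp_le not_less)
qed

lemma strict_mono_choice:
  assumes "\<And>k. eventually (P k) sequentially"
  obtains N :: "nat \<Rightarrow> nat" where "strict_mono N" "\<And>k. P k (N k)"
proof -
  have ex: "\<exists>n. P k n \<and> m < n" for k m
    using eventually_happens'[OF sequentially_bot eventually_conj[OF assms[of k] eventually_gt_at_top[of m]]]
    by blast
  have "\<exists>N. \<forall>k. P k (N k) \<and> N k < N (Suc k)"
  proof (rule dependent_nat_choice)
    show "\<exists>n. P 0 n" using ex[of 0 0] by blast
    show "\<exists>n. P (Suc k) n \<and> m < n" if "P k m" for m k by (rule ex)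
  qed
  then show ?thesis using that by (auto simp: strict_mono_Suc_iff)
qed

subsection \<open>The divergent rearrangement\<close>

text \<open>The logarithm of \<open>2 * C ^ n\<close> is at most \<open>2 * n * ln C\<close>, so
  smallness against the logarithm becomes smallness against \<open>n\<close> along these positions;
  \<open>c\<close> absorbs the factor \<open>2 * ln C\<close>. The number \<open>2 * C ^ n\<close>
  will bound the end of a block of depth \<open>n\<close>.\<close>

lemma multiplier_small_along_powers:
  fixes w :: "nat \<Rightarrow> real"
  assumes small: "w \<in> o(\<lambda>n. ln (real n))" and C: "C \<ge> (4::nat)" and \<delta>: "\<delta> > 0"
  shows "eventually (\<lambda>n. w (2 * C ^ n) \<le> real n * \<delta>) sequentially"
proof -
  define c where "c = \<delta> / (2 * ln (real C))"
  have lnC: "ln (real C) > 0" using C by simp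
  then have c0: "c > 0" using \<delta> by (simp add: c_def)
  have ge: "n \<le> 2 * C ^ n" for n
  proof -
    have "n < C ^ n" by (rule power_gt_expt) (use C in simp)
    then show ?thesis by simp
  qed
  have "filterlim (\<lambda>n. 2 * C ^ n) sequentially sequentially"
    by (rule filterlim_at_top_mono[OF filterlim_ident]) (use ge in auto)
  then have "eventually (\<lambda>n. norm (w (2 * C ^ n)) \<le> c * norm (ln (real (2 * C ^ n)))) sequentially"
    by (rule eventually_compose_filterlim[OF landau_o.smallD[OF small c0]])
  then show ?thesis
    using eventually_ge_at_top[of 1]
  proof eventually_elim
    case (elim n)
    have "real (2 * C ^ n) \<le> real (C ^ (2 * n))"
    proof -
      have "2 \<le> C ^ n" using C elim(2) power_increasing[of 1 n C] by simp
      then have "2 * C ^ n \<le> C ^ n * C ^ n" by (intro mult_right_mono) auto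
      then show ?thesis by (simp only: mult_2 power_add of_nat_le_iff)
    qed
    then have "ln (real (2 * C ^ n)) \<le> ln (real (C ^ (2 * n)))"
      using C by (intro ln_mono) auto
    also have "\<dots> = 2 * real n * ln (real C)" using C by (simp add: ln_realpow)
    finally have "c * ln (real (2 * C ^ n)) \<le> c * (2 * real n * ln (real C))"
      using c0 by (intro mult_left_mono) auto
    moreover have "ln (real (2 * C ^ n)) \<ge> 0"
    proof (rule ln_ge_zero)
      have "1 \<le> C ^ n" using C by simp
      then show "1 \<le> real (2 * C ^ n)" by linarith
    qed
    moreover have "c * (2 * real n * ln (real C)) = real n * \<delta>" using lnC by (simp add: c_def)
    ultimately show ?case using elim(1) by simp
  qed
qed

text \<open>Blocks of depth \<open>N k\<close>, scaled so that their large sums reach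
  \<open>1\<close>, have energy at most \<open>16 / N k\<close>; they end where \<open>w\<close> is
  at most \<open>N k * (1/2) ^ k\<close>, so the weighted energies are summable. By Borel-Cantelli
  almost every point lies outside all but finitely many exceptional sets.\<close>

lemma exists_divergent_rearrangement:
  fixes w :: "nat \<Rightarrow> real"
  assumes pos: "\<And>n. n \<ge> 1 \<Longrightarrow> w n > 0"
    and incr: "mono_on {1..} w"
    and small: "w \<in> o(\<lambda>n. ln (real n))"
  shows "\<exists>(a :: nat \<Rightarrow> complex) \<sigma>.
       summable (\<lambda>n. (cmod (a (Suc n)))\<^sup>2 * w (Suc n)) \<and>
       bij_betw \<sigma> {1..} {1..} \<and>
       (AE x in lebesgue_on {0<..<1}. \<not> summable (\<lambda>n. a (Suc n) * trig_system (\<sigma> (Suc n)) x))"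
proof -
  let ?M = "lebesgue_on {0<..<1::real}"
  obtain A0 where A0: "A0 \<ge> 1" "\<And>J. (\<Sum>k\<in>{- 2 * int J..2 * int J}. cmod (square_coeff J k) powr (3/2)) \<le> A0"
    using square_coeff_three_halves by blast
  \<comment> \<open>\<open>tree_block\<close> asks for the bound \<open>real A - 1\<close>, which
    accounts for the \<open>+ 1\<close>.\<close>
  define A where "A = nat \<lceil>A0\<rceil> + 1"
  have A: "(\<Sum>k\<in>{- 2 * int J..2 * int J}. cmod (square_coeff J k) powr (3/2)) \<le> real A - 1" for J
    using A0(2)[of J] real_nat_ceiling_ge[of A0] by (simp add: A_def)
  have A1: "A \<ge> 1" by (simp add: A_def)
  define C where "C = 2 * (1024 * A) ^ 4"
  have C4: "C \<ge> 4"
  proof -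
    have "2 \<le> (1024 * A) ^ 4" using A1 power_increasing[of 1 4 "1024 * A"] by simp
    then show ?thesis by (simp add: C_def)
  qed
  have evt: "eventually (\<lambda>n. w (2 * C ^ n) \<le> real n * (1/2) ^ k \<and> n \<ge> 1) sequentially" for k :: nat
    by (intro eventually_conj multiplier_small_along_powers[OF small C4] eventually_ge_at_top) simp
  obtain N where N: "strict_mono N" "\<And>k. w (2 * C ^ N k) \<le> real (N k) * (1/2) ^ k \<and> N k \<ge> 1"
    by (rule strict_mono_choice[of "\<lambda>k n. w (2 * C ^ n) \<le> real n * (1/2) ^ k \<and> n \<ge> 1", OF evt]) blast
  define is_block where "is_block k bs B \<longleftrightarrow> length bs \<le> C ^ N k \<and> distinct (map snd bs) \<and> (\<forall>p\<in>set bs. 1 \<le> snd p) \<and>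
    (\<Sum>p\<leftarrow>bs. (cmod (fst p))\<^sup>2) \<le> real (N k) \<and>
    B \<in> sets ?M \<and> measure ?M B \<le> 2 * (1/2) ^ N k \<and>
    (\<forall>x\<in>{0<..<1} - B. \<exists>xs ys zs. bs = xs @ ys @ zs \<and>
       real (N k) / 4 \<le> cmod (\<Sum>p\<leftarrow>ys. fst p * trig_system (snd p) x))" for k bs B
  have "\<exists>bs B. is_block k bs B" for k
    unfolding is_block_def C_def by (rule tree_block[OF A A1]) (use N(2)[of k] in simp)
  then obtain b B where block: "\<And>k. is_block k (b k) (B k)" by metis
  have b: "length (b k) \<le> C ^ N k" "distinct (map snd (b k))" "p \<in> set (b k) \<Longrightarrow> 1 \<le> snd p"
      "(\<Sum>p\<leftarrow>b k. (cmod (fst p))\<^sup>2) \<le> real (N k)" for k p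
    using block[of k] by (simp_all only: is_block_def)
  have B: "B k \<in> sets ?M" "measure ?M (B k) \<le> 2 * (1/2) ^ N k" for k
    using block[of k] by (simp_all only: is_block_def)
  have large: "\<exists>xs ys zs. b k = xs @ ys @ zs \<and>
       real (N k) / 4 \<le> cmod (\<Sum>p\<leftarrow>ys. fst p * trig_system (snd p) x)" if "x \<in> {0<..<1} - B k" for k x
    using block[of k] that by (simp only: is_block_def)
  define \<rho> where "\<rho> k = 4 / real (N k)" for k
  have N0: "real (N k) > 0" for k using N(2)[of k] by simp
  define scale where "scale k p = (of_real (\<rho> k) * fst p, snd p)" for k and p :: "complex \<times> nat"
  define bs where "bs k = map (scale k) (b k)" for k
  \<comment> \<open>A block starting at \<open>C ^ N k\<close> has length at most
    \<open>C ^ N k\<close>, so it ends by \<open>2 * C ^ N k\<close>, before the next start since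
    \<open>C\<close> is at least \<open>4\<close>.\<close>
  define st where "st k = C ^ N k" for k
  have st1: "st k \<ge> 1" for k using C4 by (simp add: st_def)
  have end_le: "st k + length (bs k) \<le> 2 * C ^ N k" for k using b(1)[of k] by (simp add: st_def bs_def)
  have gap: "st k + length (bs k) < st (Suc k)" for k
  proof -
    have "Suc (N k) \<le> N (Suc k)" using N(1) by (simp add: Suc_le_eq strict_mono_Suc_iff)
    then have "C * C ^ N k \<le> st (Suc k)"
      unfolding st_def using C4 power_increasing[of "Suc (N k)" "N (Suc k)" C] by simp
    moreover have "4 * C ^ N k \<le> C * C ^ N k" using C4 by (intro mult_right_mono) auto
    ultimately show ?thesis using end_le[of k] st1[of k] unfolding st_def by linarith
  qed
  have energy: "(\<Sum>p\<leftarrow>bs k. (cmod (fst p))\<^sup>2) \<le> 16 / real (N k)" for k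
  proof -
    have "(\<Sum>p\<leftarrow>bs k. (cmod (fst p))\<^sup>2) = (\<rho> k)\<^sup>2 * (\<Sum>p\<leftarrow>b k. (cmod (fst p))\<^sup>2)"
      by (simp add: bs_def o_def scale_def norm_mult power_mult_distrib sum_list_const_mult)
    also have "\<dots> \<le> (\<rho> k)\<^sup>2 * real (N k)" using b(4) by (intro mult_left_mono) auto
    also have "\<dots> = 16 / real (N k)" using N0[of k] by (simp add: \<rho>_def power2_eq_square)
    finally show ?thesis .
  qed
  have bs_distinct: "distinct (map snd (bs k))" for k
    using b(2)[of k] by (simp add: bs_def o_def scale_def)
  have bs_pos: "1 \<le> snd p" if "p \<in> set (bs k)" for k p
    using that b(3)[of _ k] by (auto simp: bs_def scale_def)
  have weights: "summable (\<lambda>k. (\<Sum>p\<leftarrow>bs k. (cmod (fst p))\<^sup>2) * w (st k + length (bs k)))"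
  proof (rule summable_comparison_test'[where N = 0])
    show "summable (\<lambda>k. 16 * (1/2::real) ^ k)" by (intro summable_mult summable_geometric) simp
    fix k
    have energy0: "(\<Sum>p\<leftarrow>bs k. (cmod (fst p))\<^sup>2) \<ge> 0" by (intro sum_list_nonneg) auto
    have w0: "w (st k + length (bs k)) > 0" using st1[of k] by (intro pos) simp
    have "w (st k + length (bs k)) \<le> w (2 * C ^ N k)"
      using end_le[of k] st1[of k] C4 by (intro mono_onD[OF incr]) auto
    also have "\<dots> \<le> real (N k) * (1/2) ^ k" using N(2) by blast
    finally have "(\<Sum>p\<leftarrow>bs k. (cmod (fst p))\<^sup>2) * w (st k + length (bs k))
        \<le> 16 / real (N k) * (real (N k) * (1/2) ^ k)"
      using energy[of k] w0 by (intro mult_mono) auto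
    also have "\<dots> = 16 * (1/2) ^ k" using N0[of k] by simp
    finally show "norm ((\<Sum>p\<leftarrow>bs k. (cmod (fst p))\<^sup>2) * w (st k + length (bs k))) \<le> 16 * (1/2) ^ k"
      using w0 energy0 by (simp add: abs_mult)
  qed
  have "\<exists>(a :: nat \<Rightarrow> complex) \<sigma>.
    summable (\<lambda>n. (cmod (a (Suc n)))\<^sup>2 * w (Suc n)) \<and> bij_betw \<sigma> {1..} {1..} \<and>
    (\<forall>k xs ys zs x. bs k = xs @ ys @ zs \<longrightarrow>
      cmod (\<Sum>n = st k + length xs..<st k + length xs + length ys. a n * trig_system (\<sigma> n) x)
      = cmod (\<Sum>p\<leftarrow>ys. fst p * trig_system (snd p) x))"
    by (rule arrange_blocks) (fact st1 gap bs_distinct bs_pos pos incr weights)+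
  then obtain a \<sigma> where
    a: "summable (\<lambda>n. (cmod (a (Suc n)))\<^sup>2 * w (Suc n))" and \<sigma>: "bij_betw \<sigma> {1..} {1..}"
    and blocks: "\<And>k xs ys zs x. bs k = xs @ ys @ zs \<Longrightarrow>
      cmod (\<Sum>n = st k + length xs..<st k + length xs + length ys. a n * trig_system (\<sigma> n) x)
      = cmod (\<Sum>p\<leftarrow>ys. fst p * trig_system (snd p) x)"
    by blast
  have N_ge: "k \<le> N k" for k by (rule strict_mono_imp_increasing[OF N(1)])
  \<comment> \<open>Since \<open>k \<le> N k\<close>, the measures of the exceptional sets are
    dominated by the geometric series \<open>2 * (1/2) ^ k\<close>.\<close>
  have "AE x in ?M. eventually (\<lambda>k. x \<in> space ?M - B k) sequentially"
  proof (rule borel_cantelli_AE1[OF B(1)])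
    interpret finite_measure ?M by (rule finite_measure_lebesgue_on) auto
    show "emeasure ?M (B k) < \<infinity>" for k by (simp add: less_top[symmetric])
    show "summable (\<lambda>k. measure ?M (B k))"
    proof (rule summable_comparison_test'[where N = 0])
      show "summable (\<lambda>k. 2 * (1/2::real) ^ k)" by (intro summable_mult summable_geometric) simp
      fix k
      have "(1/2::real) ^ N k \<le> (1/2) ^ k" using N_ge by (intro power_decreasing) auto
      then have "measure ?M (B k) \<le> 2 * (1/2) ^ k" using B(2)[of k] by linarith
      then show "norm (measure ?M (B k)) \<le> 2 * (1/2) ^ k" by simp
    qed
  qed
  then have "AE x in ?M. \<not> summable (\<lambda>n. a (Suc n) * trig_system (\<sigma> (Suc n)) x)"
  proof (rule AE_mp, intro AE_I2 impI)
    fix x assume "eventually (\<lambda>k. x \<in> space ?M - B k) sequentially"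
    then obtain k0 where k0: "\<And>k. k \<ge> k0 \<Longrightarrow> x \<in> {0<..<1} - B k"
      by (auto simp: eventually_sequentially space_restrict_space)
    show "\<not> summable (\<lambda>n. a (Suc n) * trig_system (\<sigma> (Suc n)) x)"
    proof (rule not_summable_if_large_blocks)
      fix n
      \<comment> \<open>\<open>k \<ge> k0\<close> puts \<open>x\<close> outside \<open>B k\<close>,
        and \<open>k \<ge> n\<close> makes the block start beyond \<open>n\<close>, because
        \<open>n \<le> k \<le> N k < C ^ N k\<close>.\<close>
      define k where "k = max k0 n"
      obtain xs ys zs where xyz: "b k = xs @ ys @ zs"
          "real (N k) / 4 \<le> cmod (\<Sum>p\<leftarrow>ys. fst p * trig_system (snd p) x)"
        using large[OF k0[of k]] by (auto simp: k_def)
      have "(\<Sum>p\<leftarrow>map (scale k) ys. fst p * trig_system (snd p) x)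
          = of_real (\<rho> k) * (\<Sum>p\<leftarrow>ys. fst p * trig_system (snd p) x)"
        by (simp add: o_def scale_def mult.assoc sum_list_const_mult)
      then have "cmod (\<Sum>p\<leftarrow>map (scale k) ys. fst p * trig_system (snd p) x)
          = \<rho> k * cmod (\<Sum>p\<leftarrow>ys. fst p * trig_system (snd p) x)"
        using N0[of k] by (simp add: norm_mult norm_divide \<rho>_def)
      moreover have "\<rho> k * (real (N k) / 4) \<le> \<rho> k * cmod (\<Sum>p\<leftarrow>ys. fst p * trig_system (snd p) x)"
        using xyz(2) N0[of k] by (intro mult_left_mono) (auto simp: \<rho>_def)
      moreover have "\<rho> k * (real (N k) / 4) = 1" using N0[of k] by (simp add: \<rho>_def)
      moreover have "bs k = map (scale k) xs @ map (scale k) ys @ map (scale k) zs"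
        by (simp add: bs_def xyz(1))
      ultimately have "1 \<le> cmod (\<Sum>i = st k + length xs..<st k + length xs + length ys. a i * trig_system (\<sigma> i) x)"
        using blocks[of k "map (scale k) xs" "map (scale k) ys" "map (scale k) zs" x] by simp
      moreover have "n < st k + length xs"
      proof -
        have "k \<le> N k" by (rule N_ge)
        also have "N k < C ^ N k" by (rule power_gt_expt) (use C4 in simp)
        finally show ?thesis by (simp add: st_def k_def)
      qed
      ultimately show "\<exists>i j. n < i \<and> 1 \<le> cmod (\<Sum>n = i..<j. a n * trig_system (\<sigma> n) x)" by blast
    qed
  qed
  then show ?thesis using a \<sigma> by blast
qed

theorem corollary1p2:
  fixes w :: "nat \<Rightarrow> real"
  assumes pos: "\<And>n. n \<ge> 1 \<Longrightarrow> w n > 0"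
    and incr: "mono_on {1..} w"
    and small: "w \<in> o(\<lambda>n. ln (real n))"
  shows "\<not> RC_multiplier w trig_system \<and>
    (\<exists>(a :: nat \<Rightarrow> complex) \<sigma>.
       summable (\<lambda>n. (cmod (a (Suc n)))\<^sup>2 * w (Suc n)) \<and>
       bij_betw \<sigma> {1..} {1..} \<and>
       (AE x in lebesgue_on {0<..<1}. \<not> summable (\<lambda>n. a (Suc n) * trig_system (\<sigma> (Suc n)) x)))"
proof -
  obtain a \<sigma> where a: "summable (\<lambda>n. (cmod (a (Suc n)))\<^sup>2 * w (Suc n))"
    and \<sigma>: "bij_betw \<sigma> {1..} {1..}"
    and div: "AE x in lebesgue_on {0<..<1}. \<not> summable (\<lambda>n. a (Suc n) * trig_system (\<sigma> (Suc n)) x)"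
    using exists_divergent_rearrangement[OF pos incr small] by blast
  have "\<not> RC_multiplier w trig_system"
  proof
    assume "RC_multiplier w trig_system"
    then have "AE x in lebesgue_on {0<..<1}. summable (\<lambda>n. a (Suc n) * trig_system (\<sigma> (Suc n)) x)"
      using a \<sigma> unfolding RC_multiplier_def C_multiplier_def by blast
    \<comment> \<open>Convergence and divergence almost everywhere would together make the unit
      interval a null set.\<close>
    with div have "AE x in lebesgue_on {0<..<1::real}. False" by eventually_elim simp
    then obtain Z where Z: "{x::real. 0 < x \<and> x < 1} \<subseteq> Z" "emeasure (lebesgue_on {0<..<1::real}) Z = 0"
        "Z \<in> sets (lebesgue_on {0<..<1})"
      unfolding eventually_ae_filter by (auto simp: space_restrict_space null_sets_def)
    then have "{0<..<1} \<subseteq> Z" by auto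
    then have "emeasure (lebesgue_on {0<..<1::real}) {0<..<1} \<le> 0"
      using emeasure_mono[of "{0<..<1}" Z] Z(2,3) by metis
    then show False by (simp add: emeasure_restrict_space)
  qed
  then show ?thesis using a \<sigma> div by blast
qed

end
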